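(* Let $d\ge2$, let $M=\mathbb{H}^d$ with hyperbolic distance $\rho$, and let $\alpha>0$ be fixed. Define $\Psi(x,y)=\log\cosh\rho(x,y)$ for $x,y\in M$. Then the function $$\Phi_\alpha(x,y)=\int_0^1 e^{-u^{1/\alpha}\Psi(x,y)}\,du,\qquad x,y\in M,$$ is of positive type and satisfies $$\lim_{\rho(x,y)\to\infty}\rho(x,y)^{\alpha}\,\Phi_\alpha(x,y)=\alpha\Gamma(\alpha)$$ uniformly in $x,y$. In particular, $\Phi_\alpha$ is the covariance function of a stationary Gaussian field on $M$ with uniform power decay $\rho(x,y)^{-\alpha}$ as $\rho(x,y)\to\infty$.
   Context: $\mathbb{H}^d$ is the $d$-dimensional space-form of constant curvature $-1$. A continuous function $\Phi:X\times X\to\mathbb{C}$ on a topological space $X$ is of positive type if for any $n\ge1$, $x_1,\dots,x_n\in X$ and complex numbers $c_1,\dots,c_n$ one has $\sum_{i,j=1}^n c_i\overline{c_j}\,\Phi(x_i,x_j)\ge0$. A Gaussian field on $M$ is stationary if its distribution is invariant under the action of the isometry group $\mathrm{SO}^+(d,1)$ on $M$. $\Gamma$ is the Gamma function. *)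

theory Defs
  imports "HOL-Probability.Probability"
begin

(* Hyperboloid model of H^d inside R^{d+1}, with d = CARD('n).  The time-like coordinate
   has index None, the d space-like coordinates have indices Some i. *)

definition minkowski :: "(real, 'n::finite option) vec \<Rightarrow> (real, 'n option) vec \<Rightarrow> real" where
  "minkowski x y = (\<Sum>i\<in>UNIV. x $ Some i * y $ Some i) - x $ None * y $ None"

definition hyperbolic_space :: "(real, 'n::finite option) vec set" where
  "hyperbolic_space = {x. minkowski x x = -1 \<and> x $ None > 0}"

definition hyp_dist :: "(real, 'n::finite option) vec \<Rightarrow> (real, 'n option) vec \<Rightarrow> real" where
  "hyp_dist x y = arcosh (- minkowski x y)"

(* SO^+(d,1): the last condition says that the two sheets of the hyperboloid are not exchanged. *)

definition SO_plus :: "((real, 'n::finite option) vec, 'n option) vec set" where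
  "SO_plus = {A. (\<forall>x y. minkowski (A *v x) (A *v y) = minkowski x y) \<and> det A = 1
                 \<and> A $ None $ None > 0}"

(* Membership in the nonnegative reals also says that the complex sum is real. *)

definition positive_type :: "'a::topological_space set \<Rightarrow> ('a \<Rightarrow> 'a \<Rightarrow> complex) \<Rightarrow> bool" where
  "positive_type S K \<longleftrightarrow>
     continuous_on (S \<times> S) (\<lambda>(x, y). K x y) \<and>
     (\<forall>n\<ge>1. \<forall>(x :: nat \<Rightarrow> 'a) (c :: nat \<Rightarrow> complex). (\<forall>i\<in>{1..n}. x i \<in> S) \<longrightarrow>
        (\<Sum>i=1..n. \<Sum>j=1..n. c i * cnj (c j) * K (x i) (x j)) \<in> \<real>\<^sub>\<ge>\<^sub>0)"

(* Degenerate (almost surely constant) Gaussian variables are included. *)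

definition gaussian_variable :: "'w measure \<Rightarrow> ('w \<Rightarrow> real) \<Rightarrow> bool" where
  "gaussian_variable N Y \<longleftrightarrow> Y \<in> borel_measurable N \<and>
     (\<exists>\<mu>. (AE \<omega> in N. Y \<omega> = \<mu>) \<or> (\<exists>\<sigma>>0. distributed N lborel Y (normal_density \<mu> \<sigma>)))"

definition gaussian_field :: "'w measure \<Rightarrow> 'a set \<Rightarrow> ('a \<Rightarrow> 'w \<Rightarrow> real) \<Rightarrow> bool" where
  "gaussian_field N S X \<longleftrightarrow> prob_space N \<and> (\<forall>x\<in>S. X x \<in> borel_measurable N) \<and>
     (\<forall>F c. finite F \<and> F \<subseteq> S \<longrightarrow> gaussian_variable N (\<lambda>\<omega>. \<Sum>x\<in>F. c x * X x \<omega>))"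

definition covariance :: "'w measure \<Rightarrow> ('w \<Rightarrow> real) \<Rightarrow> ('w \<Rightarrow> real) \<Rightarrow> real" where
  "covariance N Y Z = (\<integral>\<omega>. (Y \<omega> - (\<integral>\<omega>'. Y \<omega>' \<partial>N)) * (Z \<omega> - (\<integral>\<omega>'. Z \<omega>' \<partial>N)) \<partial>N)"

definition field_law :: "'w measure \<Rightarrow> 'a set \<Rightarrow> ('a \<Rightarrow> 'w \<Rightarrow> real) \<Rightarrow> ('a \<Rightarrow> real) measure" where
  "field_law N S X = distr N (\<Pi>\<^sub>M x\<in>S. borel) (\<lambda>\<omega>. \<lambda>x\<in>S. X x \<omega>)"

definition stationary :: "'w measure \<Rightarrow> ((real, 'n::finite option) vec \<Rightarrow> 'w \<Rightarrow> real) \<Rightarrow> bool" where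
  "stationary N X \<longleftrightarrow>
     (\<forall>A\<in>SO_plus. field_law N hyperbolic_space (\<lambda>x. X (A *v x)) = field_law N hyperbolic_space X)"

definition uniform_limit_at_infinity ::
    "((real, 'n::finite option) vec \<Rightarrow> (real, 'n option) vec \<Rightarrow> real) \<Rightarrow> real \<Rightarrow> bool" where
  "uniform_limit_at_infinity f L \<longleftrightarrow>
     (\<forall>\<epsilon>>0. \<exists>R. \<forall>x\<in>hyperbolic_space. \<forall>y\<in>hyperbolic_space.
        hyp_dist x y \<ge> R \<longrightarrow> \<bar>f x y - L\<bar> < \<epsilon>)"

definition uniform_power_decay ::
    "real \<Rightarrow> ((real, 'n::finite option) vec \<Rightarrow> (real, 'n option) vec \<Rightarrow> real) \<Rightarrow> bool" where
  "uniform_power_decay \<alpha> K \<longleftrightarrow>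
     (\<exists>C>0. uniform_limit_at_infinity (\<lambda>x y. hyp_dist x y powr \<alpha> * K x y) C)"

definition Psi :: "(real, 'n::finite option) vec \<Rightarrow> (real, 'n option) vec \<Rightarrow> real" where
  "Psi x y = ln (cosh (hyp_dist x y))"

definition Phi :: "real \<Rightarrow> (real, 'n::finite option) vec \<Rightarrow> (real, 'n option) vec \<Rightarrow> real" where
  "Phi \<alpha> x y = integral {0..1} (\<lambda>u. exp (- (u powr (1 / \<alpha>) * Psi x y)))"

end

theory Submission
  imports Defs "HOL-Real_Asymp.Real_Asymp"
begin

text \<open>In the hyperboloid model $\cosh\rho(x,y) = -\langle x,y\rangle = x_0 y_0 (1 - \langle v_x, v_y\rangle)$
  with $v_x$ the spatial part of $x$ divided by $x_0$, a point of the open unit ball. The binomial series of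
  $(1 - s)^{-t}$ has nonnegative coefficients and powers of an inner product are of positive type,
  so $e^{-t\Psi} = (\cosh\rho)^{-t}$ is of positive type for every $t \ge 0$; integrate over $t = u^{1/\alpha}$.
  The substitution $s = u^{1/\alpha}\Psi$ turns $\Psi^\alpha\Phi_\alpha$ into an incomplete Gamma integral, and
  $\Psi \sim \rho$. The field is the Kolmogorov extension of the finite-dimensional Gaussian laws with
  covariance $\Phi_\alpha$; consistency and stationarity both follow from the uniqueness theorem for joint
  characteristic functions, which is reduced to the one-dimensional one coordinate by coordinate.\<close>

section \<open>The hyperboloid model\<close>

text \<open>The exponent \<open>1 / \<alpha>\<close> is chosen so that t = u^(1/\<alpha>) gives du =
  \<alpha> t^(\<alpha>-1) dt: \<open>Phi \<alpha>\<close> is the mixture of the kernels e^(-t Psi)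
  over 0 < t < 1 with the Gamma weight, and its constant at infinity is the full Gamma integral.
  Uniformity costs nothing, because \<open>Phi \<alpha>\<close> depends on the two points only
  through their distance. The probabilistic half sees the kernel only through its finite quadratic
  forms Q: a field with joint characteristic functions exp(-Q/2) is Gaussian, its covariance is the
  kernel, and an invariant kernel makes it stationary. Densities would be the wrong tool, since Q
  may vanish (it does for zero coefficients) and such degenerate laws must be carried along. The
  uniqueness theorem that is invoked concerns probability measures on the line. When one coordinate
  is treated, all the others enter as a bounded complex weight, and this weight has to be turned
  into a probability density; the shift by 2 and the normalization in the weighted uniqueness lemmas
  serve that end.\<close>

definition spatial :: "(real, 'n::finite option) vec \<Rightarrow> (real, 'n) vec" where
  "spatial x = (\<chi> i. x $ Some i)"

lemma minkowski_eq_inner: "minkowski x y = spatial x \<bullet> spatial y - x $ None * y $ None"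
  by (simp add: minkowski_def spatial_def inner_vec_def)

lemma minkowski_commute: "minkowski x y = minkowski y x"
  by (simp add: minkowski_eq_inner inner_commute mult.commute)

lemma norm_spatial_hyperbolic_space:
  assumes "x \<in> hyperbolic_space"
  shows "(norm (spatial x))\<^sup>2 = (x $ None)\<^sup>2 - 1"
  using assms
  by (simp add: hyperbolic_space_def minkowski_eq_inner power2_norm_eq_inner power2_eq_square[of "x $ None"])

text \<open>Reverse Cauchy-Schwarz inequality on the upper sheet: the ordinary inequality for (1, a)
  and (1, b) bounds 1 + a b by the product of the time-like coordinates. It places
  \<open>- minkowski x y\<close> in [1, \<infinity>), where \<open>arcosh\<close> inverts
  \<open>cosh\<close> and the logarithm is nonnegative.\<close>

lemma minkowski_le_minus_one:
  assumes x: "x \<in> hyperbolic_space" and y: "y \<in> hyperbolic_space"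
  shows "minkowski x y \<le> -1"
proof -
  define a b where "a = norm (spatial x)" and "b = norm (spatial y)"
  have a: "a\<^sup>2 = (x $ None)\<^sup>2 - 1" and b: "b\<^sup>2 = (y $ None)\<^sup>2 - 1"
    using norm_spatial_hyperbolic_space[OF x] norm_spatial_hyperbolic_space[OF y]
    by (simp_all add: a_def b_def)
  have pos: "x $ None > 0" "y $ None > 0"
    using x y by (simp_all add: hyperbolic_space_def)
  have "(1 + a * b)\<^sup>2 \<le> (1 + a\<^sup>2) * (1 + b\<^sup>2)"
    using zero_le_power2[of "a - b"] by (simp add: power2_eq_square algebra_simps)
  also have "\<dots> = (x $ None * y $ None)\<^sup>2"
    by (simp add: a b power_mult_distrib)
  finally have "1 + a * b \<le> x $ None * y $ None"
    by (rule power2_le_imp_le) (use pos in simp)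
  moreover have "spatial x \<bullet> spatial y \<le> a * b"
    by (simp add: a_def b_def norm_cauchy_schwarz)
  ultimately show ?thesis
    by (simp add: minkowski_eq_inner)
qed

text \<open>The sign condition on \<open>A\<close> controls the image of the base point
  \<open>e\<close> only. If another point were sent to the lower sheet, its negated image
  \<open>p\<close> would lie on the upper sheet and have product at least 1 with
  \<open>A *v e\<close>, against the bound -1.\<close>

lemma SO_plus_hyperbolic_space:
  fixes A :: "((real, 'n::finite option) vec, 'n option) vec"
  assumes A: "A \<in> SO_plus" and x: "x \<in> hyperbolic_space"
  shows "A *v x \<in> hyperbolic_space"
proof -
  define e :: "(real, 'n option) vec" where "e = axis None 1"
  have mink: "minkowski (A *v u) (A *v v) = minkowski u v" for u v
    using A by (simp add: SO_plus_def)
  have e: "e \<in> hyperbolic_space"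
    by (simp add: e_def hyperbolic_space_def minkowski_def axis_def)
  have "(A *v e) $ None > 0"
    using A by (simp add: SO_plus_def e_def matrix_vector_mul_component inner_axis)
  then have Ae: "A *v e \<in> hyperbolic_space"
    using e by (simp add: hyperbolic_space_def mink)
  have "(A *v x) $ None > 0"
  proof (rule ccontr)
    assume neg: "\<not> (A *v x) $ None > 0"
    define p where "p = - (A *v x)"
    have mp: "minkowski p p = -1" and mpe: "minkowski p (A *v e) \<ge> 1"
      using mink[of x x] x minkowski_le_minus_one[OF x e] mink[of x e]
      by (auto simp: p_def minkowski_def sum_negf hyperbolic_space_def)
    have "p $ None \<noteq> 0"
    proof
      assume "p $ None = 0"
      with mp have "(norm (spatial p))\<^sup>2 = -1"
        by (simp add: minkowski_eq_inner power2_norm_eq_inner)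
      then show False
        using zero_le_power2[of "norm (spatial p)"] by linarith
    qed
    with neg mp have "p \<in> hyperbolic_space"
      by (simp add: hyperbolic_space_def p_def)
    from minkowski_le_minus_one[OF this Ae] mpe show False
      by simp
  qed
  then show ?thesis
    using x by (simp add: hyperbolic_space_def mink)
qed

lemma cosh_hyp_dist:
  assumes "x \<in> hyperbolic_space" "y \<in> hyperbolic_space"
  shows "cosh (hyp_dist x y) = - minkowski x y"
  using minkowski_le_minus_one[OF assms] by (simp add: hyp_dist_def)

lemma Psi_eq_ln:
  assumes "x \<in> hyperbolic_space" "y \<in> hyperbolic_space"
  shows "Psi x y = ln (- minkowski x y)"
  by (simp add: Psi_def cosh_hyp_dist[OF assms])

lemma Psi_nonneg:
  assumes "x \<in> hyperbolic_space" "y \<in> hyperbolic_space"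
  shows "Psi x y \<ge> 0"
  using minkowski_le_minus_one[OF assms] by (simp add: Psi_eq_ln[OF assms])

lemma continuous_on_Psi:
  shows "continuous_on (hyperbolic_space \<times> (hyperbolic_space :: (real, 'n::finite option) vec set))
    (\<lambda>(x, y). Psi x y)"
proof -
  have "continuous_on (hyperbolic_space \<times> hyperbolic_space :: ((real, 'n option) vec \<times> _) set)
      (\<lambda>z. - minkowski (fst z) (snd z))"
    unfolding minkowski_def by (intro continuous_intros)
  moreover have "- minkowski (fst z) (snd z) \<noteq> 0"
    if "z \<in> hyperbolic_space \<times> hyperbolic_space" for z :: "(real, 'n option) vec \<times> _"
    using minkowski_le_minus_one[of "fst z" "snd z"] that by fastforce
  ultimately have "continuous_on (hyperbolic_space \<times> hyperbolic_space :: ((real, 'n option) vec \<times> _) set)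
      (\<lambda>z. ln (- minkowski (fst z) (snd z)))"
    by (intro continuous_on_ln) auto
  then show ?thesis
    by (rule continuous_on_eq) (auto simp: Psi_eq_ln)
qed

section \<open>Continuity of \<open>Phi\<close>, inherited from that of \<open>Psi\<close>\<close>

lemma integrable_Phi_integrand:
  fixes \<alpha> :: real
  assumes "\<alpha> > 0"
  shows "(\<lambda>u. exp (- (u powr (1 / \<alpha>) * p))) integrable_on {0..1::real}"
  by (intro integrable_continuous_interval continuous_intros continuous_on_powr') (use assms in auto)

text \<open>For a weight w in [0, 1], p \<mapsto> e^(-w p) is 1-Lipschitz on p \<ge> 0, and
  averaging over w = u^(1/\<alpha>) preserves this. The bound lets continuity pass from
  \<open>Psi\<close> to \<open>Phi\<close> without any limit under the integral.\<close>

lemma Phi_diff_le: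
  assumes \<alpha>: "\<alpha> > 0" and nn: "Psi x y \<ge> 0" "Psi x' y' \<ge> 0"
  shows "\<bar>Phi \<alpha> x y - Phi \<alpha> x' y'\<bar> \<le> \<bar>Psi x y - Psi x' y'\<bar>"
proof -
  have exp_lip: "\<bar>exp (- a) - exp (- b)\<bar> \<le> \<bar>a - b\<bar>" if "a \<ge> 0" "b \<ge> 0" for a b :: real
  proof -
    have *: "exp (- a) - exp (- b) \<le> b - a \<and> exp (-b) \<le> exp (-a)" if "0 \<le> a" "a \<le> b" for a b :: real
    proof -
      have "exp (- b) = exp (- a) * exp (- (b - a))"
        by (simp flip: exp_add)
      moreover have "exp (- a) * (1 - exp (- (b - a))) \<le> 1 * (b - a)"
        using that exp_ge_add_one_self[of "- (b - a)"]
        by (intro mult_mono) (auto simp del: exp_ge_add_one_self)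
      ultimately show ?thesis
        using that by (simp add: algebra_simps)
    qed
    show ?thesis
      using *[of a b] *[of b a] that by linarith
  qed
  let ?f = "\<lambda>p u. exp (- (u powr (1 / \<alpha>) * p)) :: real"
  have "\<bar>Phi \<alpha> x y - Phi \<alpha> x' y'\<bar> = norm (integral {0..1} (\<lambda>u. ?f (Psi x y) u - ?f (Psi x' y') u))"
    by (simp add: Phi_def integral_diff integrable_Phi_integrand[OF \<alpha>])
  also have "\<dots> \<le> integral {0..1} (\<lambda>u::real. \<bar>Psi x y - Psi x' y'\<bar>)"
  proof (rule integral_norm_bound_integral)
    fix u :: real assume u: "u \<in> {0..1}"
    have "norm (?f (Psi x y) u - ?f (Psi x' y') u)
        \<le> \<bar>u powr (1 / \<alpha>) * Psi x y - u powr (1 / \<alpha>) * Psi x' y'\<bar>"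
      using nn exp_lip by simp
    also have "\<dots> = u powr (1 / \<alpha>) * \<bar>Psi x y - Psi x' y'\<bar>"
      by (simp add: abs_mult flip: right_diff_distrib)
    also have "\<dots> \<le> 1 * \<bar>Psi x y - Psi x' y'\<bar>"
      using u \<alpha> powr_mono2[of "1 / \<alpha>" u 1] by (intro mult_right_mono) auto
    finally show "norm (?f (Psi x y) u - ?f (Psi x' y') u) \<le> \<bar>Psi x y - Psi x' y'\<bar>"
      by simp
  qed (auto intro!: integrable_diff integrable_Phi_integrand[OF \<alpha>])
  finally show ?thesis
    by simp
qed

lemma continuous_on_Phi:
  assumes "\<alpha> > 0"
  shows "continuous_on (hyperbolic_space \<times> (hyperbolic_space :: (real, 'n::finite option) vec set))
    (\<lambda>(x, y). Phi \<alpha> x y)"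
  unfolding continuous_on_def
proof (intro ballI)
  fix z :: "(real, 'n option) vec \<times> (real, 'n option) vec"
  let ?H = "hyperbolic_space \<times> hyperbolic_space"
  assume z: "z \<in> ?H"
  obtain a b where ab: "z = (a, b)" by (cases z)
  have "((\<lambda>(x, y). Psi x y) \<longlongrightarrow> Psi a b) (at z within ?H)"
    using continuous_on_Psi z unfolding continuous_on_def ab by fastforce
  then have lim: "((\<lambda>w. \<bar>Psi (fst w) (snd w) - Psi a b\<bar>) \<longlongrightarrow> 0) (at z within ?H)"
    by (simp add: case_prod_unfold tendsto_rabs_zero_iff LIM_zero_iff)
  have "((\<lambda>w. Phi \<alpha> (fst w) (snd w) - Phi \<alpha> a b) \<longlongrightarrow> 0) (at z within ?H)"
  proof (rule Lim_null_comparison[OF _ lim])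
    show "\<forall>\<^sub>F w in at z within ?H.
        norm (Phi \<alpha> (fst w) (snd w) - Phi \<alpha> a b) \<le> \<bar>Psi (fst w) (snd w) - Psi a b\<bar>"
      using z ab by (auto simp: eventually_at_filter intro!: always_eventually Phi_diff_le[OF assms] Psi_nonneg)
  qed
  then show "((\<lambda>(x, y). Phi \<alpha> x y) \<longlongrightarrow> (case z of (x, y) \<Rightarrow> Phi \<alpha> x y)) (at z within ?H)"
    by (simp add: case_prod_unfold LIM_zero_iff ab)
qed

section \<open>Positive type\<close>

text \<open>A Schur product argument by hand: one factor of the inner product is expanded in
  coordinates, and the coordinate \<open>v i $ l\<close> is absorbed into the coefficient
  \<open>c i\<close>. Hence the induction runs over all \<open>c\<close> at once; it ends in the
  square of a sum.\<close>

lemma inner_power_positive_type: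
  fixes v :: "'i \<Rightarrow> (real, 'n::finite) vec"
  assumes "finite I"
  shows "(\<Sum>i\<in>I. \<Sum>j\<in>I. c i * c j * (v i \<bullet> v j) ^ k) \<ge> 0"
proof (induction k arbitrary: c)
  case 0
  have "(\<Sum>i\<in>I. \<Sum>j\<in>I. c i * c j * (v i \<bullet> v j) ^ 0) = (\<Sum>i\<in>I. c i)\<^sup>2"
    by (simp add: power2_eq_square sum_product)
  then show ?case
    by (metis zero_le_power2)
next
  case (Suc k)
  have "(\<Sum>i\<in>I. \<Sum>j\<in>I. c i * c j * (v i \<bullet> v j) ^ Suc k)
      = (\<Sum>i\<in>I. \<Sum>j\<in>I. \<Sum>l\<in>UNIV. (c i * v i $ l) * (c j * v j $ l) * (v i \<bullet> v j) ^ k)"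
    by (simp add: inner_vec_def sum_distrib_left sum_distrib_right mult_ac)
  also have "\<dots> = (\<Sum>i\<in>I. \<Sum>l\<in>UNIV. \<Sum>j\<in>I. (c i * v i $ l) * (c j * v j $ l) * (v i \<bullet> v j) ^ k)"
    by (intro sum.cong refl sum.swap)
  also have "\<dots> = (\<Sum>l\<in>UNIV. \<Sum>i\<in>I. \<Sum>j\<in>I. (c i * v i $ l) * (c j * v j $ l) * (v i \<bullet> v j) ^ k)"
    by (rule sum.swap)
  also have "\<dots> \<ge> 0"
    by (intro sum_nonneg Suc.IH)
  finally show ?case .
qed

text \<open>The binomial series at exponent -t, with its coefficients rewritten as rising factorials
  so that their sign can be read off for t \<ge> 0.\<close>

lemma sums_one_minus_powr:
  fixes s t :: real
  assumes "\<bar>s\<bar> < 1"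
  shows "(\<lambda>k. pochhammer t k / fact k * s ^ k) sums ((1 - s) powr (- t))"
proof -
  have "(\<lambda>k. ((- t) gchoose k) * (- s) ^ k) sums ((1 + (- s)) powr (- t))"
    by (rule gen_binomial_real) (use assms in simp)
  moreover have "((- t) gchoose k) * (- s) ^ k = pochhammer t k / fact k * s ^ k" for k
  proof -
    have "(- s) ^ k = (-1) ^ k * s ^ k"
      by (simp flip: power_mult_distrib)
    then show ?thesis
      by (simp add: gbinomial_pochhammer flip: power_mult_distrib)
  qed
  ultimately show ?thesis
    by simp
qed

text \<open>The factor (x0 y0)^(-t) has rank one, so it goes into the coefficients \<open>b\<close>
  and leaves positivity unaffected. What remains is a convergent series, with nonnegative
  coefficients, of powers of inner products; finite sums commute with it, and each term is
  nonnegative.\<close>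

lemma minkowski_powr_positive_type:
  fixes x :: "'i \<Rightarrow> (real, 'n::finite option) vec"
  assumes I: "finite I" and x: "\<And>i. i \<in> I \<Longrightarrow> x i \<in> hyperbolic_space" and t: "t \<ge> 0"
  shows "(\<Sum>i\<in>I. \<Sum>j\<in>I. c i * c j * (- minkowski (x i) (x j)) powr (- t)) \<ge> 0"
proof -
  \<comment> \<open>This is the Beltrami-Klein model: the hyperboloid is projected from the origin
    to the open unit ball. Strictness of \<open>norm_v\<close> gives convergence of the
    series.\<close>
  define v where "v i = inverse (x i $ None) *\<^sub>R spatial (x i)" for i
  define b where "b i = c i * (x i $ None) powr (- t)" for i
  have pos: "x i $ None > 0" if "i \<in> I" for i
    using x[OF that] by (simp add: hyperbolic_space_def)
  have norm_v: "norm (v i) < 1" if i: "i \<in> I" for i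
  proof -
    have "(norm (spatial (x i)))\<^sup>2 < (x i $ None)\<^sup>2"
      by (simp add: norm_spatial_hyperbolic_space[OF x[OF i]])
    then have "norm (spatial (x i)) < x i $ None"
      by (rule power2_less_imp_less) (use pos[OF i] in simp)
    then have "inverse (x i $ None) * norm (spatial (x i)) < inverse (x i $ None) * x i $ None"
      by (rule mult_strict_left_mono) (use pos[OF i] in simp)
    moreover have "norm (v i) = inverse (x i $ None) * norm (spatial (x i))"
      using pos[OF i] by (simp add: v_def)
    moreover have "inverse (x i $ None) * x i $ None = 1"
      using pos[OF i] by simp
    ultimately show ?thesis
      by simp
  qed
  have v: "\<bar>v i \<bullet> v j\<bar> < 1" if "i \<in> I" "j \<in> I" for i j
  proof -
    have "\<bar>v i \<bullet> v j\<bar> \<le> norm (v i) * norm (v j)"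
      by (rule Cauchy_Schwarz_ineq2)
    also have "\<dots> \<le> norm (v i) * 1"
      using norm_v[OF that(2)] by (intro mult_left_mono) auto
    finally show ?thesis
      using norm_v[OF that(1)] by simp
  qed
  have eq: "c i * c j * (- minkowski (x i) (x j)) powr (- t) = b i * b j * (1 - v i \<bullet> v j) powr (- t)"
    if ij: "i \<in> I" "j \<in> I" for i j
  proof -
    have "- minkowski (x i) (x j) = x i $ None * x j $ None * (1 - v i \<bullet> v j)"
      using pos[OF ij(1)] pos[OF ij(2)] by (simp add: minkowski_eq_inner v_def field_simps)
    then show ?thesis
      using pos[OF ij(1)] pos[OF ij(2)] v[OF ij] by (simp add: powr_mult b_def)
  qed
  have sums: "(\<lambda>k. \<Sum>i\<in>I. \<Sum>j\<in>I. b i * b j * (pochhammer t k / fact k * (v i \<bullet> v j) ^ k))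
      sums (\<Sum>i\<in>I. \<Sum>j\<in>I. b i * b j * (1 - v i \<bullet> v j) powr (- t))"
    by (intro sums_sum sums_mult sums_one_minus_powr v)
  have nonneg: "0 \<le> (\<Sum>i\<in>I. \<Sum>j\<in>I. b i * b j * (pochhammer t k / fact k * (v i \<bullet> v j) ^ k))" for k
  proof -
    have "(\<Sum>i\<in>I. \<Sum>j\<in>I. b i * b j * (pochhammer t k / fact k * (v i \<bullet> v j) ^ k))
        = pochhammer t k / fact k * (\<Sum>i\<in>I. \<Sum>j\<in>I. b i * b j * (v i \<bullet> v j) ^ k)"
      by (simp add: sum_distrib_left mult_ac)
    also have "\<dots> \<ge> 0"
      using t by (intro mult_nonneg_nonneg inner_power_positive_type I divide_nonneg_pos)
        (auto simp: pochhammer_prod intro!: prod_nonneg)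
    finally show ?thesis .
  qed
  have "0 \<le> (\<Sum>i\<in>I. \<Sum>j\<in>I. b i * b j * (1 - v i \<bullet> v j) powr (- t))"
    unfolding sums_unique[OF sums] by (rule suminf_nonneg[OF sums_summable[OF sums] nonneg])
  also have "\<dots> = (\<Sum>i\<in>I. \<Sum>j\<in>I. c i * c j * (- minkowski (x i) (x j)) powr (- t))"
    by (intro sum.cong refl eq[symmetric])
  finally show ?thesis .
qed

lemma Phi_positive_type_real:
  fixes x :: "'i \<Rightarrow> (real, 'n::finite option) vec"
  assumes \<alpha>: "\<alpha> > 0" and I: "finite I" and x: "\<And>i. i \<in> I \<Longrightarrow> x i \<in> hyperbolic_space"
  shows "(\<Sum>i\<in>I. \<Sum>j\<in>I. c i * c j * Phi \<alpha> (x i) (x j)) \<ge> 0"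
proof -
  let ?f = "\<lambda>i j u. exp (- (u powr (1 / \<alpha>) * Psi (x i) (x j)))"
  have "(\<Sum>i\<in>I. \<Sum>j\<in>I. c i * c j * Phi \<alpha> (x i) (x j))
      = integral {0..1} (\<lambda>u. \<Sum>i\<in>I. \<Sum>j\<in>I. c i * c j * ?f i j u)"
    unfolding Phi_def
    by (simp add: integral_sum integrable_sum integrable_on_mult_right integrable_Phi_integrand \<alpha> I)
  also have "\<dots> \<ge> 0"
  proof (rule integral_nonneg)
    fix u :: real
    assume "u \<in> {0..1}"
    have "?f i j u = (- minkowski (x i) (x j)) powr (- (u powr (1 / \<alpha>)))" if "i \<in> I" "j \<in> I" for i j
      using minkowski_le_minus_one[OF x[OF that(1)] x[OF that(2)]]
      by (simp add: powr_def Psi_eq_ln x that)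
    then show "0 \<le> (\<Sum>i\<in>I. \<Sum>j\<in>I. c i * c j * ?f i j u)"
      using minkowski_powr_positive_type[where c=c and x=x and t="u powr (1 / \<alpha>)", OF I x] by simp
  qed (auto intro!: integrable_sum integrable_on_mult_right integrable_Phi_integrand \<alpha> I)
  finally show ?thesis .
qed

text \<open>With c = a + i b, symmetry of \<open>K\<close> makes the mixed terms in the imaginary
  part cancel, and the form becomes the sum of the real forms at a and at b.\<close>

lemma positive_type_of_real:
  fixes K :: "'a::topological_space \<Rightarrow> 'a \<Rightarrow> real"
  assumes cont: "continuous_on (S \<times> S) (\<lambda>(x, y). K x y)"
    and sym: "\<And>x y. K x y = K y x"
    and pos: "\<And>(I :: nat set) x c. finite I \<Longrightarrow> (\<And>i. i \<in> I \<Longrightarrow> x i \<in> S) \<Longrightarrow>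
      (\<Sum>i\<in>I. \<Sum>j\<in>I. c i * c j * K (x i) (x j)) \<ge> 0"
  shows "positive_type S (\<lambda>x y. complex_of_real (K x y))"
  unfolding positive_type_def
proof (intro conjI allI impI)
  show "continuous_on (S \<times> S) (\<lambda>(x, y). complex_of_real (K x y))"
    using cont by (auto simp: case_prod_beta intro: continuous_on_of_real)
next
  fix n :: nat and x :: "nat \<Rightarrow> 'a" and c :: "nat \<Rightarrow> complex"
  assume x: "\<forall>i\<in>{1..n}. x i \<in> S"
  let ?Q = "\<lambda>a b. \<Sum>i=1..n. \<Sum>j=1..n. a i * b j * K (x i) (x j)"
  have swap: "?Q (Re \<circ> c) (Im \<circ> c) = ?Q (Im \<circ> c) (Re \<circ> c)"
    by (subst sum.swap) (intro sum.cong refl, simp add: sym mult_ac)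
  have "(\<Sum>i=1..n. \<Sum>j=1..n. c i * cnj (c j) * complex_of_real (K (x i) (x j)))
      = complex_of_real (?Q (Re \<circ> c) (Re \<circ> c) + ?Q (Im \<circ> c) (Im \<circ> c))"
    using swap by (simp add: complex_eq_iff sum.distrib sum_subtractf algebra_simps)
  moreover have "?Q (Re \<circ> c) (Re \<circ> c) + ?Q (Im \<circ> c) (Im \<circ> c) \<ge> 0"
    by (intro add_nonneg_nonneg pos) (use x in auto)
  ultimately show "(\<Sum>i=1..n. \<Sum>j=1..n. c i * cnj (c j) * complex_of_real (K (x i) (x j))) \<in> \<real>\<^sub>\<ge>\<^sub>0"
    by (simp only: nonneg_Reals_of_real_iff)
qed

lemma Phi_commute: "Phi \<alpha> x y = Phi \<alpha> y x"
  by (simp add: Phi_def Psi_def hyp_dist_def minkowski_commute[of x y])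

section \<open>Decay at infinity\<close>

text \<open>The change of variable is split at v = \<open>p powr \<alpha>\<close> * u = s^\<alpha>:
  the first half is linear and produces the factor in front, the second produces the Gamma
  weight.\<close>

lemma powr_Phi_eq:
  fixes \<alpha> :: real
  assumes \<alpha>: "\<alpha> > 0" and p: "p \<ge> 0"
  shows "p powr \<alpha> * integral {0..1} (\<lambda>u. exp (- (u powr (1 / \<alpha>) * p)))
    = integral {0..p} (\<lambda>s. \<alpha> * s powr (\<alpha> - 1) * exp (- s))"
proof -
  let ?f = "\<lambda>v::real. exp (- (v powr (1 / \<alpha>)))"
  have cont: "continuous_on {0..p powr \<alpha>} ?f"
    by (intro continuous_intros continuous_on_powr') (use \<alpha> in auto)
  have "((\<lambda>u. p powr \<alpha> *\<^sub>R ?f (u * p powr \<alpha>)) has_integral integral {0 * p powr \<alpha>..1 * p powr \<alpha>} ?f) {0..1}"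
    by (rule has_integral_substitution[where c=0 and d="p powr \<alpha>"])
      (auto intro!: cont derivative_eq_intros mult_left_le_one_le)
  moreover have "?f (u * p powr \<alpha>) = exp (- (u powr (1 / \<alpha>) * p))" if "u \<in> {0..1}" for u
    using that p \<alpha> by (simp add: powr_mult powr_powr)
  ultimately have "((\<lambda>u. p powr \<alpha> * exp (- (u powr (1 / \<alpha>) * p))) has_integral integral {0..p powr \<alpha>} ?f) {0..1}"
    by (subst (asm) has_integral_cong[where g="\<lambda>u. p powr \<alpha> * exp (- (u powr (1 / \<alpha>) * p))"]) auto
  then have "p powr \<alpha> * integral {0..1} (\<lambda>u. exp (- (u powr (1 / \<alpha>) * p))) = integral {0..p powr \<alpha>} ?f"
    by (simp add: has_integral_iff)
  \<comment> \<open>For \<alpha> < 1 the map s \<mapsto> s^\<alpha> has no finite derivative at 0,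
    so 0 is made an exceptional point and only continuity is asked there.\<close>
  moreover have "((\<lambda>s. (\<alpha> * s powr (\<alpha> - 1)) *\<^sub>R ?f (s powr \<alpha>)) has_integral integral {0 powr \<alpha>..p powr \<alpha>} ?f) {0..p}"
  proof (rule has_integral_substitution_strong[where s="{0}" and c=0 and d="p powr \<alpha>"])
    show "continuous_on {0..p} (\<lambda>s. s powr \<alpha>)"
      by (intro continuous_intros continuous_on_powr') (use \<alpha> in auto)
    show "((\<lambda>s. s powr \<alpha>) has_real_derivative \<alpha> * x powr (\<alpha> - 1)) (at x within {0..p})"
      if "x \<in> {0..p} - {0}" for x
      using that by (auto intro!: derivative_eq_intros simp: powr_diff field_simps)
  qed (use \<alpha> p cont in \<open>auto intro!: powr_mono2\<close>)
  moreover have "?f (s powr \<alpha>) = exp (- s)" if "s \<in> {0..p}" for s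
    using that \<alpha> by (simp add: powr_powr)
  ultimately have "((\<lambda>s. \<alpha> * s powr (\<alpha> - 1) * exp (- s)) has_integral integral {0..p powr \<alpha>} ?f) {0..p}
    \<and> p powr \<alpha> * integral {0..1} (\<lambda>u. exp (- (u powr (1 / \<alpha>) * p))) = integral {0..p powr \<alpha>} ?f"
    using \<alpha> by (subst has_integral_cong[where g="\<lambda>s. (\<alpha> * s powr (\<alpha> - 1)) *\<^sub>R ?f (s powr \<alpha>)"]) auto
  then show ?thesis
    by (simp add: has_integral_iff)
qed

text \<open>A gauge integral over an unbounded set is approximated by integrals over boxes that
  contain a large ball. The box [-p, p] meets the half-line exactly in [0, p].\<close>

lemma tendsto_incomplete_Gamma:
  fixes \<alpha> :: real
  assumes "\<alpha> > 0"
  shows "((\<lambda>p. integral {0..p} (\<lambda>s. \<alpha> * s powr (\<alpha> - 1) * exp (- s))) \<longlongrightarrow> \<alpha> * Gamma \<alpha>) at_top"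
proof -
  let ?f = "\<lambda>s. \<alpha> * s powr (\<alpha> - 1) * exp (- s)"
  have "(?f has_integral \<alpha> * Gamma \<alpha>) {0..}"
    using has_integral_mult_right[OF Gamma_integral_real[OF assms], of \<alpha>]
    by (simp add: exp_minus divide_inverse mult_ac)
  then have *: "\<exists>B>0. \<forall>a b. ball 0 B \<subseteq> cbox a b \<longrightarrow>
      norm (integral (cbox a b) (\<lambda>s. if s \<in> {0..} then ?f s else 0) - \<alpha> * Gamma \<alpha>) < e"
    if "e > 0" for e
    using that by (subst (asm) has_integral_alt') auto
  show ?thesis
  proof (rule tendstoI)
    fix e :: real assume "e > 0"
    then obtain B where B: "B > 0" "\<And>a b. ball 0 B \<subseteq> cbox a b \<Longrightarrow>
        norm (integral (cbox a b) (\<lambda>s. if s \<in> {0..} then ?f s else 0) - \<alpha> * Gamma \<alpha>) < e"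
      using * by blast
    have "dist (integral {0..p} ?f) (\<alpha> * Gamma \<alpha>) < e" if "p \<ge> B" for p
    proof -
      have "ball 0 B \<subseteq> cbox (- p) p"
        using that by (auto simp: dist_real_def)
      then have "norm (integral (cbox (-p) p) (\<lambda>s. if s \<in> {0..} then ?f s else 0) - \<alpha> * Gamma \<alpha>) < e"
        by (rule B)
      also have "integral (cbox (-p) p) (\<lambda>s. if s \<in> {0..} then ?f s else 0) = integral ({0..} \<inter> {-p..p}) ?f"
        by (simp only: integral_restrict_Int box_real)
      also have "{0..} \<inter> {-p..p} = {0..p}"
        using that B by auto
      finally show ?thesis
        by (simp add: dist_norm)
    qed
    then show "\<forall>\<^sub>F p in at_top. dist (integral {0..p} ?f) (\<alpha> * Gamma \<alpha>) < e"
      by (auto simp: eventually_at_top_linorder)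
  qed
qed

lemma uniform_limit_Phi:
  fixes \<alpha> :: real
  assumes \<alpha>: "\<alpha> > 0"
  shows "uniform_limit_at_infinity
    (\<lambda>(x :: (real, 'n::finite option) vec) y. hyp_dist x y powr \<alpha> * Phi \<alpha> x y) (\<alpha> * Gamma \<alpha>)"
proof -
  let ?I = "\<lambda>p. integral {0..1} (\<lambda>u. exp (- (u powr (1 / \<alpha>) * p)))"
  let ?\<psi> = "\<lambda>r::real. ln (cosh r)"
  have "filterlim ?\<psi> at_top at_top"
    unfolding cosh_field_def by real_asymp
  from filterlim_compose[OF tendsto_incomplete_Gamma[OF \<alpha>] this]
  have 1: "((\<lambda>r. integral {0..?\<psi> r} (\<lambda>s. \<alpha> * s powr (\<alpha> - 1) * exp (- s))) \<longlongrightarrow> \<alpha> * Gamma \<alpha>) at_top" .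
  \<comment> \<open>Here ln (cosh r) = r - ln 2 + o(1).\<close>
  have 2: "((\<lambda>r. (r / ?\<psi> r) powr \<alpha>) \<longlongrightarrow> 1) at_top"
    unfolding cosh_field_def by real_asymp
  have "((\<lambda>r. r powr \<alpha> * ?I (?\<psi> r)) \<longlongrightarrow> 1 * (\<alpha> * Gamma \<alpha>)) at_top"
  proof (rule Lim_transform_eventually[OF tendsto_mult[OF 2 1]])
    show "\<forall>\<^sub>F r in at_top. (r / ?\<psi> r) powr \<alpha> * integral {0..?\<psi> r} (\<lambda>s. \<alpha> * s powr (\<alpha> - 1) * exp (- s))
        = r powr \<alpha> * ?I (?\<psi> r)"
      using eventually_gt_at_top[of 0]
    proof eventually_elim
      case (elim r)
      have "1 < cosh r"
        using cosh_real_strict_mono[of 0 r] elim by simp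
      then have pos: "?\<psi> r > 0"
        by simp
      show ?case
        using elim pos
        by (simp add: powr_divide flip: powr_Phi_eq[OF \<alpha> less_imp_le[OF pos]])
    qed
  qed
  then have lim: "((\<lambda>r. r powr \<alpha> * ?I (?\<psi> r)) \<longlongrightarrow> \<alpha> * Gamma \<alpha>) at_top"
    by simp
  show ?thesis
    unfolding uniform_limit_at_infinity_def
  proof (intro allI impI)
    fix \<epsilon> :: real assume "\<epsilon> > 0"
    from tendstoD[OF lim this] obtain R where "\<And>r. r \<ge> R \<Longrightarrow> dist (r powr \<alpha> * ?I (?\<psi> r)) (\<alpha> * Gamma \<alpha>) < \<epsilon>"
      by (auto simp: eventually_at_top_linorder)
    then show "\<exists>R. \<forall>x\<in>hyperbolic_space. \<forall>y\<in>hyperbolic_space. R \<le> hyp_dist x y \<longrightarrow>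
        \<bar>hyp_dist x y powr \<alpha> * Phi \<alpha> x y - \<alpha> * Gamma \<alpha>\<bar> < \<epsilon>"
      by (intro exI[of _ R]) (auto simp: Phi_def Psi_def dist_real_def)
  qed
qed

section \<open>Uniqueness of laws with given joint characteristic functions\<close>

lemma (in prob_space) integrable_bounded_mult_iexp:
  fixes g :: "'a \<Rightarrow> complex"
  assumes [measurable]: "g \<in> borel_measurable M" "h \<in> borel_measurable M"
    and "\<And>\<omega>. norm (g \<omega>) \<le> C"
  shows "integrable M (\<lambda>\<omega>. g \<omega> * iexp (h \<omega>))"
  by (rule integrable_const_bound[where B=C]) (use assms in \<open>auto simp: norm_mult\<close>)

text \<open>A signed weight does not define a probability measure, so 2 + g, which lies in [1, 3],
  is used as a density after division by its mass \<open>Z\<close>. The added constant contributes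
  the unweighted transforms, which is where \<open>char\<close> enters beside \<open>wchar\<close>;
  its share is subtracted at the end.\<close>

lemma weighted_char_eq_imp_real:
  fixes g :: "'a \<Rightarrow> real" and g' :: "'b \<Rightarrow> real"
  assumes "prob_space M" "prob_space N"
    and meas [measurable]: "X \<in> borel_measurable M" "g \<in> borel_measurable M"
      "Y \<in> borel_measurable N" "g' \<in> borel_measurable N"
    and bound: "\<And>\<omega>. \<bar>g \<omega>\<bar> \<le> 1" "\<And>\<omega>. \<bar>g' \<omega>\<bar> \<le> 1"
    and char: "\<And>s. (CLINT \<omega>|M. iexp (s * X \<omega>)) = (CLINT \<omega>|N. iexp (s * Y \<omega>))"
    and wchar: "\<And>s. (CLINT \<omega>|M. of_real (g \<omega>) * iexp (s * X \<omega>))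
      = (CLINT \<omega>|N. of_real (g' \<omega>) * iexp (s * Y \<omega>))"
    and B [measurable]: "B \<in> sets borel"
  shows "(LINT \<omega>|M. g \<omega> * indicator B (X \<omega>)) = (LINT \<omega>|N. g' \<omega> * indicator B (Y \<omega>))"
proof -
  interpret M: prob_space M by fact
  interpret N: prob_space N by fact
  \<comment> \<open>With 1 + g the mass could be zero; the constant 2 ensures
    \<open>Z \<ge> 1\<close>. The same \<open>Z\<close> normalizes both sides, by
    \<open>wchar\<close> at frequency 0.\<close>
  define Z where "Z = (LINT \<omega>|M. 2 + g \<omega>)"
  have int [simp, intro]: "integrable M g" "integrable N g'"
    by (auto intro!: M.integrable_const_bound[where B=1] N.integrable_const_bound[where B=1] simp: bound)
  have "(LINT \<omega>|M. g \<omega>) = (LINT \<omega>|N. g' \<omega>)"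
    using wchar[of 0] by simp
  then have Z': "Z = (LINT \<omega>|N. 2 + g' \<omega>)"
    by (simp add: Z_def M.prob_space N.prob_space)
  have "(LINT \<omega>|M. -1) \<le> (LINT \<omega>|M. g \<omega>)"
    using bound(1) by (intro integral_mono) (auto simp: abs_le_iff minus_le_iff)
  then have Z: "Z \<ge> 1"
    by (simp add: Z_def M.prob_space)
  have g1: "2 + g \<omega> \<ge> 0" "2 + g' \<omega>' \<ge> 0" for \<omega> \<omega>'
    using bound(1)[of \<omega>] bound(2)[of \<omega>'] by linarith+
  define MM where "MM = density M (\<lambda>\<omega>. (2 + g \<omega>) / Z)"
  define NN where "NN = density N (\<lambda>\<omega>. (2 + g' \<omega>) / Z)"
  have [measurable_cong, simp]: "sets MM = sets M" "sets NN = sets N"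
    by (simp_all add: MM_def NN_def)
  have "emeasure MM (space MM) = (\<integral>\<^sup>+\<omega>. ennreal ((2 + g \<omega>) / Z) \<partial>M)"
    by (simp add: MM_def emeasure_density cong: nn_integral_cong)
  also have "\<dots> = ennreal (LINT \<omega>|M. (2 + g \<omega>) / Z)"
    using Z g1 by (intro nn_integral_eq_integral) auto
  also have "(LINT \<omega>|M. (2 + g \<omega>) / Z) = 1"
    using Z by (simp add: Z_def)
  finally have "prob_space MM"
    by (intro prob_spaceI) simp
  then interpret MM: prob_space MM .
  have "emeasure NN (space NN) = (\<integral>\<^sup>+\<omega>. ennreal ((2 + g' \<omega>) / Z) \<partial>N)"
    by (simp add: NN_def emeasure_density cong: nn_integral_cong)
  also have "\<dots> = ennreal (LINT \<omega>|N. (2 + g' \<omega>) / Z)"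
    using Z g1 by (intro nn_integral_eq_integral) auto
  also have "(LINT \<omega>|N. (2 + g' \<omega>) / Z) = 1"
    using Z by (simp add: Z')
  finally have "prob_space NN"
    by (intro prob_spaceI) simp
  then interpret NN: prob_space NN .
  have eqM: "distr M borel X = distr N borel Y"
  proof (rule Levy_uniqueness)
    show "char (distr M borel X) = char (distr N borel Y)"
      by (rule ext) (simp add: char_def integral_distr char del: of_real_mult)
  qed simp_all
  have "distr MM borel X = distr NN borel Y"
  proof (rule Levy_uniqueness)
    show "char (distr MM borel X) = char (distr NN borel Y)"
    proof
      fix s
      have intM: "integrable M (\<lambda>\<omega>. of_real (g \<omega>) * iexp (s * X \<omega>))"
        and intN: "integrable N (\<lambda>\<omega>. of_real (g' \<omega>) * iexp (s * Y \<omega>))"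
        by (intro M.integrable_bounded_mult_iexp[where C=1] N.integrable_bounded_mult_iexp[where C=1];
            simp add: bound)+
      have "char (distr MM borel X) s = (CLINT \<omega>|M. ((2 + g \<omega>) / Z) *\<^sub>R iexp (s * X \<omega>))"
        using Z g1 by (simp add: char_def integral_distr MM_def integral_density del: of_real_mult)
      also have "\<dots> = (CLINT \<omega>|M. (2 / Z) *\<^sub>R iexp (s * X \<omega>) + (1 / Z) *\<^sub>R (of_real (g \<omega>) * iexp (s * X \<omega>)))"
        using Z by (intro Bochner_Integration.integral_cong) (auto simp: scaleR_conv_of_real field_simps)
      also have "\<dots> = (2 / Z) *\<^sub>R (CLINT \<omega>|M. iexp (s * X \<omega>)) + (1 / Z) *\<^sub>R (CLINT \<omega>|M. of_real (g \<omega>) * iexp (s * X \<omega>))"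
        by (simp add: intM M.integrable_iexp del: of_real_mult)
      also have "\<dots> = (2 / Z) *\<^sub>R (CLINT \<omega>|N. iexp (s * Y \<omega>)) + (1 / Z) *\<^sub>R (CLINT \<omega>|N. of_real (g' \<omega>) * iexp (s * Y \<omega>))"
        by (simp only: char wchar)
      also have "\<dots> = (CLINT \<omega>|N. (2 / Z) *\<^sub>R iexp (s * Y \<omega>) + (1 / Z) *\<^sub>R (of_real (g' \<omega>) * iexp (s * Y \<omega>)))"
        by (simp add: intN N.integrable_iexp del: of_real_mult)
      also have "\<dots> = (CLINT \<omega>|N. ((2 + g' \<omega>) / Z) *\<^sub>R iexp (s * Y \<omega>))"
        using Z by (intro Bochner_Integration.integral_cong) (auto simp: scaleR_conv_of_real field_simps)
      also have "\<dots> = char (distr NN borel Y) s"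
        using Z g1 by (simp add: char_def integral_distr NN_def integral_density del: of_real_mult)
      finally show "char (distr MM borel X) s = char (distr NN borel Y) s" .
    qed
  qed (auto intro: MM.real_distribution_distr NN.real_distribution_distr)
  then have "(LINT x|distr MM borel X. indicator B x :: real) = (LINT x|distr NN borel Y. indicator B x)"
    by (simp only:)
  also have "(LINT x|distr MM borel X. indicator B x) = (LINT \<omega>|M. ((2 + g \<omega>) / Z) * indicator B (X \<omega>))"
    using Z g1 by (subst integral_distr) (simp_all add: MM_def integral_density)
  also have "(LINT x|distr NN borel Y. indicator B x) = (LINT \<omega>|N. ((2 + g' \<omega>) / Z) * indicator B (Y \<omega>))"
    using Z g1 by (subst integral_distr) (simp_all add: NN_def integral_density)
  finally have "(LINT \<omega>|M. (2 + g \<omega>) * indicator B (X \<omega>)) = (LINT \<omega>|N. (2 + g' \<omega>) * indicator B (Y \<omega>))"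
    using Z by simp
  moreover have "(LINT \<omega>|M. indicator B (X \<omega>)) = (LINT \<omega>|N. indicator B (Y \<omega>) :: real)"
    using integral_distr[of X M borel "indicator B :: real \<Rightarrow> real"]
      integral_distr[of Y N borel "indicator B :: real \<Rightarrow> real"] eqM by simp
  moreover have "(LINT \<omega>|M. (2 + g \<omega>) * indicator B (X \<omega>)) = 2 * (LINT \<omega>|M. indicator B (X \<omega>)) + (LINT \<omega>|M. g \<omega> * indicator B (X \<omega>))"
    unfolding distrib_right
    by (subst Bochner_Integration.integral_add)
     (auto intro!: M.integrable_const_bound[where B=1] integrable_real_mult_indicator simp: bound split: split_indicator)
  moreover have "(LINT \<omega>|N. (2 + g' \<omega>) * indicator B (Y \<omega>)) = 2 * (LINT \<omega>|N. indicator B (Y \<omega>)) + (LINT \<omega>|N. g' \<omega> * indicator B (Y \<omega>))"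
    unfolding distrib_right
    by (subst Bochner_Integration.integral_add)
     (auto intro!: N.integrable_const_bound[where B=1] integrable_real_mult_indicator simp: bound split: split_indicator)
  ultimately show ?thesis
    by linarith
qed

text \<open>The real and imaginary parts of the weight are combinations of the weight and its
  conjugate, so the real case applies to each once the conjugate weights are known to have equal
  transforms.\<close>

lemma weighted_char_eq_imp:
  fixes g :: "'a \<Rightarrow> complex" and g' :: "'b \<Rightarrow> complex"
  assumes "prob_space M" "prob_space N"
    and meas [measurable]: "X \<in> borel_measurable M" "g \<in> borel_measurable M"
      "Y \<in> borel_measurable N" "g' \<in> borel_measurable N"
    and bound: "\<And>\<omega>. norm (g \<omega>) \<le> 1" "\<And>\<omega>. norm (g' \<omega>) \<le> 1"
    and char: "\<And>s. (CLINT \<omega>|M. iexp (s * X \<omega>)) = (CLINT \<omega>|N. iexp (s * Y \<omega>))"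
    and wchar: "\<And>s. (CLINT \<omega>|M. g \<omega> * iexp (s * X \<omega>)) = (CLINT \<omega>|N. g' \<omega> * iexp (s * Y \<omega>))"
    and B [measurable]: "B \<in> sets borel"
  shows "(CLINT \<omega>|M. g \<omega> * indicator B (X \<omega>)) = (CLINT \<omega>|N. g' \<omega> * indicator B (Y \<omega>))"
proof -
  interpret M: prob_space M by fact
  interpret N: prob_space N by fact
  have [measurable]: "cnj \<in> borel_measurable borel"
    by (intro borel_measurable_continuous_onI continuous_intros)
  have intM: "integrable M (\<lambda>\<omega>. g \<omega> * iexp (s * X \<omega>))" "integrable M (\<lambda>\<omega>. cnj (g \<omega>) * iexp (s * X \<omega>))" for s
    by (intro M.integrable_bounded_mult_iexp[where C=1]; simp add: bound)+
  have intN: "integrable N (\<lambda>\<omega>. g' \<omega> * iexp (s * Y \<omega>))" "integrable N (\<lambda>\<omega>. cnj (g' \<omega>) * iexp (s * Y \<omega>))" for s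
    by (intro N.integrable_bounded_mult_iexp[where C=1]; simp add: bound)+
  \<comment> \<open>Conjugation reverses the frequency: the transform for the conjugate weight at s
    is the conjugate of the original one at -s.\<close>
  have wcnj: "(CLINT \<omega>|M. cnj (g \<omega>) * iexp (s * X \<omega>)) = (CLINT \<omega>|N. cnj (g' \<omega>) * iexp (s * Y \<omega>))" for s
  proof -
    have "(CLINT \<omega>|M. cnj (g \<omega>) * iexp (s * X \<omega>)) = cnj (CLINT \<omega>|M. g \<omega> * iexp ((-s) * X \<omega>))"
      by (simp add: exp_cnj flip: Bochner_Integration.integral_cnj)
    also have "\<dots> = cnj (CLINT \<omega>|N. g' \<omega> * iexp ((-s) * Y \<omega>))"
      by (simp only: wchar)
    also have "\<dots> = (CLINT \<omega>|N. cnj (g' \<omega>) * iexp (s * Y \<omega>))"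
      by (simp add: exp_cnj flip: Bochner_Integration.integral_cnj)
    finally show ?thesis .
  qed
  have Re_eq: "of_real (Re z) = (z + cnj z) / 2" and Im_eq: "of_real (Im z) = (z - cnj z) / (2 * \<i>)" for z
    by (simp_all add: complex_eq_iff)
  have "(CLINT \<omega>|M. of_real (Re (g \<omega>)) * iexp (s * X \<omega>)) = (CLINT \<omega>|N. of_real (Re (g' \<omega>)) * iexp (s * Y \<omega>))" for s
    unfolding Re_eq times_divide_eq_left distrib_right
    using intM intN by (simp add: wchar wcnj del: of_real_mult)
  then have Re: "(LINT \<omega>|M. Re (g \<omega>) * indicator B (X \<omega>)) = (LINT \<omega>|N. Re (g' \<omega>) * indicator B (Y \<omega>))"
    by (intro weighted_char_eq_imp_real assms)
      (auto intro: order_trans[OF abs_Re_le_cmod bound(1)] order_trans[OF abs_Re_le_cmod bound(2)])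
  have "(CLINT \<omega>|M. of_real (Im (g \<omega>)) * iexp (s * X \<omega>)) = (CLINT \<omega>|N. of_real (Im (g' \<omega>)) * iexp (s * Y \<omega>))" for s
    unfolding Im_eq times_divide_eq_left left_diff_distrib
    using intM intN by (simp add: wchar wcnj del: of_real_mult)
  then have Im: "(LINT \<omega>|M. Im (g \<omega>) * indicator B (X \<omega>)) = (LINT \<omega>|N. Im (g' \<omega>) * indicator B (Y \<omega>))"
    by (intro weighted_char_eq_imp_real assms)
      (auto intro: order_trans[OF abs_Im_le_cmod bound(1)] order_trans[OF abs_Im_le_cmod bound(2)])
  have "integrable M (\<lambda>\<omega>. g \<omega> * indicator B (X \<omega>))" "integrable N (\<lambda>\<omega>. g' \<omega> * indicator B (Y \<omega>))"
    by (auto intro!: M.integrable_const_bound[where B=1] N.integrable_const_bound[where B=1]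
        simp: bound split: split_indicator)
  moreover have Re_ind: "Re (z * indicator B y) = Re z * indicator B y"
    and Im_ind: "Im (z * indicator B y) = Im z * indicator B y" for z y
    by (simp_all split: split_indicator)
  ultimately show ?thesis
    using Re Im by (simp add: complex_eq_iff Re_ind Im_ind flip: integral_Re integral_Im)
qed

text \<open>Replaces the exponential by indicators one coordinate at a time; each step is the
  one-dimensional uniqueness theorem for a complex weight.\<close>

lemma joint_char_eq_imp_indicator:
  fixes X :: "'i \<Rightarrow> 'a \<Rightarrow> real" and Y :: "'i \<Rightarrow> 'b \<Rightarrow> real"
  assumes "prob_space M" "prob_space N"
    and J: "finite J" and "A \<subseteq> J"
    and X: "\<And>i. i \<in> J \<Longrightarrow> X i \<in> borel_measurable M" and Y: "\<And>i. i \<in> J \<Longrightarrow> Y i \<in> borel_measurable N"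
    and char: "\<And>t. (CLINT \<omega>|M. iexp (\<Sum>i\<in>J. t i * X i \<omega>)) = (CLINT \<omega>|N. iexp (\<Sum>i\<in>J. t i * Y i \<omega>))"
    and B: "\<And>i. i \<in> J \<Longrightarrow> B i \<in> sets borel"
  shows "(CLINT \<omega>|M. (\<Prod>i\<in>A. indicator (B i) (X i \<omega>)) * iexp (\<Sum>i\<in>J - A. t i * X i \<omega>))
    = (CLINT \<omega>|N. (\<Prod>i\<in>A. indicator (B i) (Y i \<omega>)) * iexp (\<Sum>i\<in>J - A. t i * Y i \<omega>))"
  using finite_subset[OF \<open>A \<subseteq> J\<close> J] \<open>A \<subseteq> J\<close>
proof (induction A arbitrary: t rule: finite_induct)
  case empty
  then show ?case
    by (simp add: char del: of_real_sum of_real_mult)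
next
  case (insert k A)
  have k: "k \<in> J" and kA: "J - A = insert k (J - insert k A)"
    using insert by auto
  have A: "A \<subseteq> J"
    using insert by simp
  note [measurable] = X[OF k] Y[OF k] B[OF k]
  let ?g = "\<lambda>X \<omega>. (\<Prod>i\<in>A. indicator (B i) (X i \<omega>)) * iexp (\<Sum>i\<in>J - insert k A. t i * X i \<omega>) :: complex"
  have norm_g: "norm (?g X \<omega>) \<le> 1" for X :: "'i \<Rightarrow> 'c \<Rightarrow> real" and \<omega>
    by (auto simp: norm_mult intro!: prod_le_1 simp flip: prod_norm split: split_indicator)
  have split_sum: "(\<Sum>i\<in>J - A. (t(k := s)) i * X i \<omega>) = s * X k \<omega> + (\<Sum>i\<in>J - insert k A. t i * X i \<omega>)"
    for X :: "'i \<Rightarrow> 'c \<Rightarrow> real" and \<omega> s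
    unfolding kA by (subst sum.insert) (use J in \<open>auto intro!: sum.cong\<close>)
  have "(CLINT \<omega>|M. ?g X \<omega> * indicator (B k) (X k \<omega>)) = (CLINT \<omega>|N. ?g Y \<omega> * indicator (B k) (Y k \<omega>))"
  proof (rule weighted_char_eq_imp[OF assms(1,2)])
    show "?g X \<in> borel_measurable M" "?g Y \<in> borel_measurable N"
      using A X Y B by (auto intro!: borel_measurable_times borel_measurable_prod borel_measurable_sum
          borel_measurable_exp borel_measurable_of_real borel_measurable_indicator' measurable_sets_borel)
  next
    fix s
    show "(CLINT \<omega>|M. iexp (s * X k \<omega>)) = (CLINT \<omega>|N. iexp (s * Y k \<omega>))"
      using char[of "\<lambda>i. if i = k then s else 0"] J k
      by (simp add: if_distrib if_distribR sum.delta cong: if_cong)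
    \<comment> \<open>The frequency s of the coordinate \<open>k\<close> is written into
      \<open>t\<close>; for this reason \<open>t\<close> is arbitrary in the induction.\<close>
    show "(CLINT \<omega>|M. ?g X \<omega> * iexp (s * X k \<omega>)) = (CLINT \<omega>|N. ?g Y \<omega> * iexp (s * Y k \<omega>))"
      using insert.IH[OF A, of "t(k := s)"] unfolding split_sum
      by (simp add: distrib_left exp_add mult_ac)
  qed (use norm_g in auto)
  then show ?case
    using insert.hyps by (simp add: mult_ac)
qed

text \<open>Cylinders over finitely many coordinates determine a finite measure on the product, so
  agreement on them is enough.\<close>

lemma field_law_eqI:
  fixes X :: "'i \<Rightarrow> 'a \<Rightarrow> real" and Y :: "'i \<Rightarrow> 'b \<Rightarrow> real"
  assumes "prob_space M" "prob_space N"
    and X: "\<And>i. i \<in> I \<Longrightarrow> X i \<in> borel_measurable M" and Y: "\<And>i. i \<in> I \<Longrightarrow> Y i \<in> borel_measurable N"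
    and char: "\<And>J t. finite J \<Longrightarrow> J \<subseteq> I \<Longrightarrow>
      (CLINT \<omega>|M. iexp (\<Sum>i\<in>J. t i * X i \<omega>)) = (CLINT \<omega>|N. iexp (\<Sum>i\<in>J. t i * Y i \<omega>))"
  shows "field_law M I X = field_law N I Y"
  unfolding field_law_def
proof (rule measure_eqI_PiM_infinite)
  interpret M: prob_space M by fact
  interpret N: prob_space N by fact
  have mX [measurable]: "(\<lambda>\<omega>. \<lambda>i\<in>I. X i \<omega>) \<in> M \<rightarrow>\<^sub>M (\<Pi>\<^sub>M i\<in>I. borel)"
    and mY [measurable]: "(\<lambda>\<omega>. \<lambda>i\<in>I. Y i \<omega>) \<in> N \<rightarrow>\<^sub>M (\<Pi>\<^sub>M i\<in>I. borel)"
    using X Y by (auto intro: measurable_restrict)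
  show "finite_measure (distr M (\<Pi>\<^sub>M i\<in>I. borel) (\<lambda>\<omega>. \<lambda>i\<in>I. X i \<omega>))"
    by (intro M.finite_measure_distr mX)
  fix A :: "'i \<Rightarrow> real set" and J
  assume J: "finite J" "J \<subseteq> I" and A: "\<And>i. i \<in> J \<Longrightarrow> A i \<in> sets borel"
  have XJ: "X i \<in> borel_measurable M" and YJ: "Y i \<in> borel_measurable N" if "i \<in> J" for i
    using X Y J that by auto
  have ind: "(\<Prod>i\<in>J. indicator (A i) (Z i \<omega>)) = complex_of_real (indicator {\<omega>\<in>S. \<forall>i\<in>J. Z i \<omega> \<in> A i} \<omega>)"
    if "\<omega> \<in> S" for Z :: "'i \<Rightarrow> 'c \<Rightarrow> real" and \<omega> S
    using that J by (auto simp: indicator_def prod_zero_iff)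
  have [measurable]: "{\<omega> \<in> space M. \<forall>i\<in>J. X i \<omega> \<in> A i} \<in> sets M" "{\<omega> \<in> space N. \<forall>i\<in>J. Y i \<omega> \<in> A i} \<in> sets N"
    using J A XJ YJ by (auto intro!: sets.sets_Collect_finite_All measurable_sets_borel predE pred_sets2)
  have emb: "(\<lambda>\<omega>. \<lambda>i\<in>I. Z i \<omega>) -` prod_emb I (\<lambda>_. borel) J (Pi\<^sub>E J A) \<inter> S = {\<omega>\<in>S. \<forall>i\<in>J. Z i \<omega> \<in> A i}"
    for Z :: "'i \<Rightarrow> 'c \<Rightarrow> real" and S
    using J by (auto simp: prod_emb_def PiE_iff subset_eq)
  \<comment> \<open>All coordinates in \<open>J\<close> have been converted to indicators here, so
    the exponential has an empty sum and equals 1.\<close>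
  have "(CLINT \<omega>|M. \<Prod>i\<in>J. indicator (A i) (X i \<omega>)) = (CLINT \<omega>|N. \<Prod>i\<in>J. indicator (A i) (Y i \<omega>))"
    using joint_char_eq_imp_indicator[OF assms(1,2) J(1) order.refl XJ YJ char[OF J] A] by simp
  then have "measure M {\<omega> \<in> space M. \<forall>i\<in>J. X i \<omega> \<in> A i} = measure N {\<omega> \<in> space N. \<forall>i\<in>J. Y i \<omega> \<in> A i}"
    by (simp add: ind[of _ "space M"] ind[of _ "space N"] cong: Bochner_Integration.integral_cong)
  moreover have "prod_emb I (\<lambda>_. borel) J (Pi\<^sub>E J A) \<in> sets (\<Pi>\<^sub>M i\<in>I. (borel :: real measure))"
    using J A by (intro sets_PiM_I) auto
  ultimately show "distr M (\<Pi>\<^sub>M i\<in>I. borel) (\<lambda>\<omega>. \<lambda>i\<in>I. X i \<omega>) (prod_emb I (\<lambda>_. borel) J (Pi\<^sub>E J A))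
      = distr N (\<Pi>\<^sub>M i\<in>I. borel) (\<lambda>\<omega>. \<lambda>i\<in>I. Y i \<omega>) (prod_emb I (\<lambda>_. borel) J (Pi\<^sub>E J A))"
    by (simp add: emeasure_distr emb M.emeasure_eq_measure N.emeasure_eq_measure)
qed simp_all

section \<open>Gaussian fields with given covariance\<close>

text \<open>Finite sets with a coefficient function match the linear combinations in
  \<open>gaussian_field\<close>. Symmetry is a separate clause because real quadratic forms see only
  the symmetric part of \<open>K\<close>.\<close>

definition psd_on :: "'i set \<Rightarrow> ('i \<Rightarrow> 'i \<Rightarrow> real) \<Rightarrow> bool" where
  "psd_on S K \<longleftrightarrow> (\<forall>x\<in>S. \<forall>y\<in>S. K x y = K y x) \<and>
    (\<forall>F c. finite F \<longrightarrow> F \<subseteq> S \<longrightarrow> (\<Sum>x\<in>F. \<Sum>y\<in>F. c x * c y * K x y) \<ge> 0)"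

lemma psd_onD:
  assumes "psd_on S K"
  shows psd_on_sym: "x \<in> S \<Longrightarrow> y \<in> S \<Longrightarrow> K x y = K y x"
    and psd_on_nonneg: "finite F \<Longrightarrow> F \<subseteq> S \<Longrightarrow> (\<Sum>x\<in>F. \<Sum>y\<in>F. c x * c y * K x y) \<ge> 0"
  using assms by (simp_all add: psd_on_def)

lemma psd_on_subset: "psd_on S K \<Longrightarrow> T \<subseteq> S \<Longrightarrow> psd_on T K"
  unfolding psd_on_def by (meson subset_iff order_trans)

text \<open>The form on \<open>insert z F\<close>, viewed as a polynomial in the coefficient s of
  \<open>z\<close>. Its nonnegativity for all s yields both the vanishing of the row of a zero pivot
  and the positivity of the Schur complement.\<close>

lemma psd_on_quadratic_insert:
  fixes c :: "'i \<Rightarrow> real"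
  assumes "psd_on S K" "finite F" "F \<subseteq> S" "z \<in> S" "z \<notin> F"
  shows "(\<Sum>x\<in>F. \<Sum>y\<in>F. c x * c y * K x y) + 2 * s * (\<Sum>x\<in>F. c x * K x z) + s\<^sup>2 * K z z \<ge> 0"
proof -
  let ?c = "c(z := s)"
  have ne: "x \<noteq> z" if "x \<in> F" for x
    using that assms by auto
  have sym: "K z x = K x z" if "x \<in> F" for x
    using psd_on_sym[OF assms(1)] assms that by auto
  have "0 \<le> (\<Sum>x\<in>insert z F. \<Sum>y\<in>insert z F. ?c x * ?c y * K x y)"
    using assms by (intro psd_on_nonneg) auto
  also have "\<dots> = s * s * K z z + (\<Sum>y\<in>F. s * c y * K z y)
      + ((\<Sum>x\<in>F. c x * s * K x z) + (\<Sum>x\<in>F. \<Sum>y\<in>F. c x * c y * K x y))"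
    using assms by (simp add: ne sum.distrib cong: sum.cong)
  also have "(\<Sum>y\<in>F. s * c y * K z y) = s * (\<Sum>x\<in>F. c x * K x z)"
    by (simp add: sum_distrib_left sym mult_ac)
  also have "(\<Sum>x\<in>F. c x * s * K x z) = s * (\<Sum>x\<in>F. c x * K x z)"
    by (simp add: sum_distrib_left mult_ac)
  finally show ?thesis
    by (simp add: power2_eq_square algebra_simps)
qed

text \<open>Cholesky elimination of one point \<open>z\<close> at a time. A zero pivot forces its
  whole row to vanish; otherwise the Schur complement \<open>K'\<close> is again positive
  semidefinite. The columns are indexed by \<open>J\<close> itself, so one independent normal
  variable per point will suffice.\<close>

lemma psd_on_factorization:
  assumes "finite J" "psd_on J K"
  shows "\<exists>a. \<forall>x\<in>J. \<forall>y\<in>J. K x y = (\<Sum>j\<in>J. a x j * a y j)"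
  using assms
proof (induction J arbitrary: K rule: finite_induct)
  case (insert z J)
  have psd: "psd_on (insert z J) K"
    by fact
  have zz: "K z z \<ge> 0"
    using psd_on_nonneg[OF psd, of "{z}" "\<lambda>_. 1"] by simp
  have sym: "K x y = K y x" if "x \<in> insert z J" "y \<in> insert z J" for x y
    using psd_on_sym[OF psd] that by auto
  have ne: "x \<noteq> z" if "x \<in> J" for x
    using that insert by auto
  note quad = psd_on_quadratic_insert[OF psd _ _ insertI1]
  show ?case
  proof (cases "K z z = 0")
    case True
    have Kxz: "K x z = 0" if x: "x \<in> J" for x
    proof (rule ccontr)
      assume nz: "K x z \<noteq> 0"
      have "K x x + 2 * s * K x z \<ge> 0" for s
        using quad[of "{x}" "\<lambda>_. 1" s] x ne[OF x] True by auto
      \<comment> \<open>A function that is affine in s with nonzero slope cannot stay nonnegative;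
        at this s its value is -1.\<close>
      from this[of "- (K x x + 1) / (2 * K x z)"] nz show False
        by (simp add: field_simps)
    qed
    obtain a where a: "\<And>x y. x \<in> J \<Longrightarrow> y \<in> J \<Longrightarrow> K x y = (\<Sum>j\<in>J. a x j * a y j)"
      using insert.IH[OF psd_on_subset[OF psd subset_insertI]] by blast
    define b where "b x j = (if x = z \<or> j = z then 0 else a x j)" for x j
    have Kzx: "K z x = 0" if "x \<in> J" for x
      using Kxz[OF that] sym[of z x] that by simp
    have "K x y = (\<Sum>j\<in>insert z J. b x j * b y j)" if "x \<in> insert z J" "y \<in> insert z J" for x y
    proof -
      have "(\<Sum>j\<in>J. b x j * b y j) = (if x = z \<or> y = z then 0 else \<Sum>j\<in>J. a x j * a y j)"
        using ne by (auto simp: b_def intro!: sum.cong)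
      moreover have "K x y = (if x = z \<or> y = z then 0 else \<Sum>j\<in>J. a x j * a y j)"
        using that True Kxz Kzx a by auto
      moreover have "b x z * b y z = 0"
        by (simp add: b_def)
      ultimately show ?thesis
        using insert.hyps by simp
    qed
    then show ?thesis
      by blast
  next
    case False
    then have pos: "K z z > 0"
      using zz by simp
    define K' where "K' x y = K x y - K x z * K y z / K z z" for x y
    have "psd_on J K'"
      unfolding psd_on_def
    proof (intro conjI ballI allI impI)
      fix F and c :: "'a \<Rightarrow> real"
      assume F: "finite F" "F \<subseteq> J"
      let ?s = "\<Sum>x\<in>F. c x * K x z"
      \<comment> \<open>The chosen coefficient of \<open>z\<close> is the minimizer of the quadratic
        in s.\<close>
      have "0 \<le> (\<Sum>x\<in>F. \<Sum>y\<in>F. c x * c y * K x y) + 2 * (- ?s / K z z) * ?s + (- ?s / K z z)\<^sup>2 * K z z"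
        using F insert.hyps by (intro quad) auto
      also have "\<dots> = (\<Sum>x\<in>F. \<Sum>y\<in>F. c x * c y * K x y) - ?s * ?s / K z z"
        using pos by (simp add: power2_eq_square field_simps)
      also have "\<dots> = (\<Sum>x\<in>F. \<Sum>y\<in>F. c x * c y * K' x y)"
        unfolding sum_product K'_def
        by (simp add: sum_divide_distrib right_diff_distrib sum_subtractf mult_ac)
      finally show "0 \<le> (\<Sum>x\<in>F. \<Sum>y\<in>F. c x * c y * K' x y)" .
    qed (auto simp: K'_def sym)
    then obtain a where a: "\<And>x y. x \<in> J \<Longrightarrow> y \<in> J \<Longrightarrow> K' x y = (\<Sum>j\<in>J. a x j * a y j)"
      using insert.IH by blast
    \<comment> \<open>The column of \<open>z\<close> accounts for the rank-one part removed from
      \<open>K\<close>. The rest of the row of \<open>z\<close> is zero because \<open>K'\<close>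
      vanishes there.\<close>
    define b where "b x j = (if j = z then K x z / sqrt (K z z) else if x = z then 0 else a x j)" for x j
    have "K x y = (\<Sum>j\<in>insert z J. b x j * b y j)" if "x \<in> insert z J" "y \<in> insert z J" for x y
    proof -
      have "(\<Sum>j\<in>J. b x j * b y j) = (if x = z \<or> y = z then 0 else K' x y)"
        using that ne by (auto simp: b_def a cong: sum.cong)
      moreover have "b x z * b y z = K x z * K y z / K z z"
        using pos by (simp add: b_def)
      ultimately show ?thesis
        using insert.hyps pos sym[OF that] by (auto simp: K'_def)
    qed
    then show ?thesis
      by blast
  qed
qed simp

text \<open>The law is the image of independent standard normals under the matrix \<open>a\<close>,
  so a singular \<open>K\<close> needs no special case.\<close>

lemma finite_gaussian_exists:
  assumes J: "finite J" and psd: "psd_on J K"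
  shows "\<exists>P. prob_space P \<and> sets P = sets (\<Pi>\<^sub>M j\<in>J. borel) \<and>
    (\<forall>c. (CLINT \<omega>|P. iexp (\<Sum>x\<in>J. c x * \<omega> x)) = of_real (exp (- (\<Sum>x\<in>J. \<Sum>y\<in>J. c x * c y * K x y) / 2)))"
proof -
  obtain a where a: "\<And>x y. x \<in> J \<Longrightarrow> y \<in> J \<Longrightarrow> K x y = (\<Sum>j\<in>J. a x j * a y j)"
    using psd_on_factorization[OF assms] by blast
  interpret std: prob_space std_normal_distribution
    using real_dist_normal_dist by (simp add: real_distribution_def)
  interpret product_sigma_finite "\<lambda>_::'a. std_normal_distribution"
    by (intro product_sigma_finite.intro std.sigma_finite_measure_axioms)
  let ?Q = "\<Pi>\<^sub>M j\<in>J. std_normal_distribution"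
  let ?T = "\<lambda>\<omega>. \<lambda>x\<in>J. \<Sum>j\<in>J. a x j * \<omega> j"
  interpret Q: prob_space ?Q
    by (intro prob_space_PiM std.prob_space_axioms)
  have T: "?T \<in> ?Q \<rightarrow>\<^sub>M (\<Pi>\<^sub>M j\<in>J. borel)"
    by (intro measurable_restrict borel_measurable_sum borel_measurable_times borel_measurable_const)
      (simp cong: measurable_cong_sets)
  have "(CLINT \<omega>|distr ?Q (\<Pi>\<^sub>M j\<in>J. borel) ?T. iexp (\<Sum>x\<in>J. c x * \<omega> x))
      = of_real (exp (- (\<Sum>x\<in>J. \<Sum>y\<in>J. c x * c y * K x y) / 2))" for c
  proof -
    \<comment> \<open>These are the coefficients of the same linear combination in the independent
      variables: \<open>c\<close> multiplied by the transpose of \<open>a\<close>.\<close>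
    define b where "b j = (\<Sum>x\<in>J. c x * a x j)" for j
    have lin: "(\<Sum>x\<in>J. c x * ?T \<omega> x) = (\<Sum>j\<in>J. b j * \<omega> j)" for \<omega>
      unfolding b_def sum_distrib_right
      by (subst sum.swap) (simp add: sum_distrib_left mult_ac)
    have "(CLINT \<omega>|distr ?Q (\<Pi>\<^sub>M j\<in>J. borel) ?T. iexp (\<Sum>x\<in>J. c x * \<omega> x))
        = (CLINT \<omega>|?Q. iexp (\<Sum>x\<in>J. c x * ?T \<omega> x))"
      by (intro integral_distr T) measurable
    also have "\<dots> = (CLINT \<omega>|?Q. \<Prod>j\<in>J. iexp (b j * \<omega> j))"
      unfolding lin using J by (simp add: sum_distrib_left flip: exp_sum)
    also have "\<dots> = (\<Prod>j\<in>J. CLINT x|std_normal_distribution. iexp (b j * x))"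
      using J by (intro product_integral_prod std.integrable_iexp) auto
    also have "\<dots> = (\<Prod>j\<in>J. of_real (exp (- (b j)\<^sup>2 / 2)))"
      using char_std_normal_distribution by (simp add: char_def fun_eq_iff)
    also have "\<dots> = of_real (exp (- (\<Sum>j\<in>J. (b j)\<^sup>2) / 2))"
      using J by (simp add: sum_divide_distrib flip: of_real_prod exp_sum sum_negf)
    also have "(\<Sum>j\<in>J. (b j)\<^sup>2) = (\<Sum>j\<in>J. \<Sum>x\<in>J. \<Sum>y\<in>J. c x * c y * (a x j * a y j))"
      by (simp add: b_def power2_eq_square sum_product mult_ac)
    also have "\<dots> = (\<Sum>x\<in>J. \<Sum>j\<in>J. \<Sum>y\<in>J. c x * c y * (a x j * a y j))"
      by (rule sum.swap)
    also have "\<dots> = (\<Sum>x\<in>J. \<Sum>y\<in>J. \<Sum>j\<in>J. c x * c y * (a x j * a y j))"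
      by (intro sum.cong refl sum.swap)
    also have "\<dots> = (\<Sum>x\<in>J. \<Sum>y\<in>J. c x * c y * K x y)"
      by (simp add: a sum_distrib_left)
    finally show ?thesis .
  qed
  moreover have "prob_space (distr ?Q (\<Pi>\<^sub>M j\<in>J. borel) ?T)"
    by (intro Q.prob_space_distr T)
  ultimately show ?thesis
    by (intro exI[of _ "distr ?Q (\<Pi>\<^sub>M j\<in>J. borel) ?T"]) simp
qed

text \<open>The probability space is the function space itself and the field is evaluation at
  points. The finite-dimensional laws are arbitrary choices; their prescribed transforms determine
  them, and this makes the choices consistent.\<close>

lemma gaussian_process_exists:
  fixes K :: "'i \<Rightarrow> 'i \<Rightarrow> real"
  assumes psd: "psd_on I K"
  shows "\<exists>N :: ('i \<Rightarrow> real) measure. prob_space N \<and> (\<forall>x\<in>I. (\<lambda>\<omega>. \<omega> x) \<in> borel_measurable N) \<and>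
    (\<forall>F c. finite F \<longrightarrow> F \<subseteq> I \<longrightarrow>
      (CLINT \<omega>|N. iexp (\<Sum>x\<in>F. c x * \<omega> x)) = of_real (exp (- (\<Sum>x\<in>F. \<Sum>y\<in>F. c x * c y * K x y) / 2)))"
proof -
  define G where "G J P \<longleftrightarrow> prob_space P \<and> sets P = sets (\<Pi>\<^sub>M j\<in>J. borel) \<and>
    (\<forall>c. (CLINT \<omega>|P. iexp (\<Sum>x\<in>J. c x * \<omega> x)) = of_real (exp (- (\<Sum>x\<in>J. \<Sum>y\<in>J. c x * c y * K x y) / 2)))"
    for J and P :: "('i \<Rightarrow> real) measure"
  have "\<exists>P. G J P" if "finite J" "J \<subseteq> I" for J
    unfolding G_def by (rule finite_gaussian_exists[OF that(1) psd_on_subset[OF psd that(2)]])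
  then obtain P where G: "\<And>J. finite J \<Longrightarrow> J \<subseteq> I \<Longrightarrow> G J (P J)"
    by metis
  have prob: "prob_space (P J)" and sets: "sets (P J) = sets (\<Pi>\<^sub>M j\<in>J. borel)"
    and char: "(CLINT \<omega>|P J. iexp (\<Sum>x\<in>J. c x * \<omega> x)) = of_real (exp (- (\<Sum>x\<in>J. \<Sum>y\<in>J. c x * c y * K x y) / 2))"
    if "finite J" "J \<subseteq> I" for J c
    using G[OF that] unfolding G_def by blast+
  \<comment> \<open>Coefficients on \<open>F\<close> are extended by 0 to \<open>J\<close>, so the
    law for \<open>J\<close> also has the prescribed transforms on its subsets.\<close>
  have char_sub: "(CLINT \<omega>|P J. iexp (\<Sum>x\<in>F. c x * \<omega> x)) = of_real (exp (- (\<Sum>x\<in>F. \<Sum>y\<in>F. c x * c y * K x y) / 2))"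
    if J: "finite J" "J \<subseteq> I" "F \<subseteq> J" for J F c
  proof -
    let ?d = "\<lambda>x. if x \<in> F then c x else 0"
    have restr: "(\<Sum>x\<in>J. ?d x * h x) = (\<Sum>x\<in>F. c x * h x)" for h
      using J by (intro sum.mono_neutral_cong_right) auto
    have "(\<Sum>x\<in>J. \<Sum>y\<in>J. ?d x * ?d y * K x y) = (\<Sum>x\<in>J. ?d x * (\<Sum>y\<in>J. ?d y * K x y))"
      by (simp only: sum_distrib_left mult.assoc)
    also have "\<dots> = (\<Sum>x\<in>F. \<Sum>y\<in>F. c x * c y * K x y)"
      unfolding restr by (simp only: sum_distrib_left mult.assoc)
    finally show ?thesis
      using char[OF J(1,2), of ?d] unfolding restr by simp
  qed
  have comp: "(\<lambda>\<omega>. \<omega> i) \<in> borel_measurable (P J)" if "finite J" "J \<subseteq> I" "i \<in> J" for i J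
    using sets[OF that(1,2)] that(3) by (simp cong: measurable_cong_sets)
  interpret polish_projective I P
  proof (intro polish_projective.intro projective_family.intro)
    fix J H :: "'i set"
    assume JH: "J \<subseteq> H" "finite H" "H \<subseteq> I"
    then have J: "finite J" "J \<subseteq> I"
      by (auto intro: finite_subset)
    \<comment> \<open>The law of the evaluations on \<open>J\<close> is the identity image of
      \<open>P J\<close> on the left and the restriction image of \<open>P H\<close> on the right,
      so this equation is the consistency condition.\<close>
    have "field_law (P J) J (\<lambda>i \<omega>. \<omega> i) = field_law (P H) J (\<lambda>i \<omega>. \<omega> i)"
    proof (rule field_law_eqI)
      show "(CLINT \<omega>|P J. iexp (\<Sum>i\<in>F. t i * \<omega> i)) = (CLINT \<omega>|P H. iexp (\<Sum>i\<in>F. t i * \<omega> i))"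
        if "F \<subseteq> J" for F t
        using that JH J by (subst (1 2) char_sub) auto
    qed (use JH J prob comp in auto)
    moreover have "field_law (P J) J (\<lambda>i \<omega>. \<omega> i) = distr (P J) (\<Pi>\<^sub>M j\<in>J. borel) (\<lambda>\<omega>. \<omega>)"
      unfolding field_law_def
      using sets_eq_imp_space_eq[OF sets[OF J]]
      by (intro distr_cong refl) (auto simp: space_PiM PiE_def extensional_restrict)
    moreover have "\<dots> = P J"
      by (rule distr_id2[OF sets[OF J, symmetric]])
    ultimately show "P J = distr (P H) (\<Pi>\<^sub>M j\<in>J. borel) (\<lambda>f. restrict f J)"
      by (simp add: field_law_def restrict_def)
  qed (rule prob)
  \<comment> \<open>Agreement on cylinders is restated as an equality of image measures, so that
    integrals can be transferred to the limit.\<close>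
  have lim: "P J = distr lim (\<Pi>\<^sub>M j\<in>J. borel) (\<lambda>f. restrict f J)" if J: "finite J" "J \<subseteq> I" for J
  proof (rule measure_eqI)
    fix X assume "X \<in> sets (P J)"
    then have X: "X \<in> sets (\<Pi>\<^sub>M j\<in>J. borel)"
      by (simp add: sets[OF J])
    then have "emeasure (distr lim (\<Pi>\<^sub>M j\<in>J. borel) (\<lambda>f. restrict f J)) X = emeasure lim (emb I J X)"
      using J by (subst emeasure_distr) (auto simp: prod_emb_def space_PiM intro!: measurable_restrict_subset cong: measurable_cong_sets)
    then show "emeasure (P J) X = emeasure (distr lim (\<Pi>\<^sub>M j\<in>J. borel) (\<lambda>f. restrict f J)) X"
      using emeasure_lim_emb[OF J(2,1) X] by simp
  qed (simp add: sets[OF J])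
  show ?thesis
  proof (intro exI[of _ lim] conjI ballI allI impI)
    show "prob_space lim"
      by (rule P.prob_space_axioms)
    show "(\<lambda>\<omega>. \<omega> x) \<in> borel_measurable lim" if "x \<in> I" for x
      using that by (simp cong: measurable_cong_sets)
    fix F and c :: "'i \<Rightarrow> real"
    assume F: "finite F" "F \<subseteq> I"
    have "(CLINT \<omega>|P F. iexp (\<Sum>x\<in>F. c x * \<omega> x)) = (CLINT \<omega>|lim. iexp (\<Sum>x\<in>F. c x * restrict \<omega> F x))"
      unfolding lim[OF F]
      using F by (intro integral_distr) (auto intro!: measurable_restrict_subset cong: measurable_cong_sets)
    also have "\<dots> = (CLINT \<omega>|lim. iexp (\<Sum>x\<in>F. c x * \<omega> x))"
      by simp
    finally show "(CLINT \<omega>|lim. iexp (\<Sum>x\<in>F. c x * \<omega> x)) = of_real (exp (- (\<Sum>x\<in>F. \<Sum>y\<in>F. c x * c y * K x y) / 2))"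
      using char[OF F] by simp
  qed
qed

section \<open>From characteristic functions to Gaussian variables, moments and covariances\<close>

lemma distr_eq_scaled_std_normal:
  assumes "prob_space N" and Y: "Y \<in> borel_measurable N" and v: "v \<ge> 0"
    and char: "\<And>s. (CLINT \<omega>|N. iexp (s * Y \<omega>)) = of_real (exp (- (s\<^sup>2 * v) / 2))"
  shows "distr N borel Y = distr std_normal_distribution borel (\<lambda>x. sqrt v * x)"
proof (rule Levy_uniqueness)
  interpret N: prob_space N by fact
  interpret std: real_distribution std_normal_distribution
    by (rule real_dist_normal_dist)
  have Q: "(\<lambda>x. sqrt v * x) \<in> borel_measurable std_normal_distribution"
    by simp
  show "real_distribution (distr N borel Y)"
    using Y by (rule N.real_distribution_distr)
  show "real_distribution (distr std_normal_distribution borel (\<lambda>x. sqrt v * x))"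
    using Q by (rule std.real_distribution_distr)
  show "char (distr N borel Y) = char (distr std_normal_distribution borel (\<lambda>x. sqrt v * x))"
  proof
    fix s
    have "char (distr N borel Y) s = (CLINT \<omega>|N. iexp (s * Y \<omega>))"
      using Y by (simp add: char_def integral_distr del: of_real_mult)
    also have "\<dots> = char std_normal_distribution (s * sqrt v)"
      using v by (simp add: char char_std_normal_distribution power_mult_distrib del: of_real_mult)
    also have "\<dots> = (CLINT x|std_normal_distribution. iexp (s * (sqrt v * x)))"
      by (simp only: char_def mult.assoc)
    also have "\<dots> = char (distr std_normal_distribution borel (\<lambda>x. sqrt v * x)) s"
      by (simp add: char_def integral_distr del: of_real_mult)
    finally show "char (distr N borel Y) s = char (distr std_normal_distribution borel (\<lambda>x. sqrt v * x)) s" .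
  qed
qed

text \<open>Since the law is that of sqrt v times a standard normal variable, integrability and
  moments are read off from the standard ones, also for v = 0. The two cases separate only in
  \<open>gaussian_variable\<close>, where v = 0 gives the almost surely constant
  alternative.\<close>

lemma gaussian_char_imp:
  assumes "prob_space N" and Y [measurable]: "Y \<in> borel_measurable N" and v: "v \<ge> 0"
    and char: "\<And>s. (CLINT \<omega>|N. iexp (s * Y \<omega>)) = of_real (exp (- (s\<^sup>2 * v) / 2))"
  shows gaussian_variableI: "gaussian_variable N Y"
    and gaussian_mean: "(LINT \<omega>|N. Y \<omega>) = 0"
    and gaussian_integrable_square: "integrable N (\<lambda>\<omega>. (Y \<omega>)\<^sup>2)"
    and gaussian_second_moment: "(LINT \<omega>|N. (Y \<omega>)\<^sup>2) = v"
proof -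
  interpret std: real_distribution std_normal_distribution
    by (rule real_dist_normal_dist)
  have eq: "distr N borel Y = distr std_normal_distribution borel (\<lambda>x. sqrt v * x)"
    by (rule distr_eq_scaled_std_normal[OF assms])
  have int_iff: "integrable N (\<lambda>\<omega>. h (Y \<omega>)) \<longleftrightarrow> integrable std_normal_distribution (\<lambda>x. h (sqrt v * x))"
    and int_eq: "(LINT \<omega>|N. h (Y \<omega>)) = (LINT x|std_normal_distribution. h (sqrt v * x))"
    if [measurable]: "h \<in> borel_measurable borel" for h :: "real \<Rightarrow> real"
    using integrable_distr_eq[of Y N borel h] integral_distr[of Y N borel h]
      integrable_distr_eq[of "\<lambda>x. sqrt v * x" std_normal_distribution borel h]
      integral_distr[of "\<lambda>x. sqrt v * x" std_normal_distribution borel h]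
    unfolding eq by simp_all
  show "integrable N (\<lambda>\<omega>. (Y \<omega>)\<^sup>2)"
    using int_iff[of "\<lambda>x. x\<^sup>2"] integrable_std_normal_distribution_moment[of 2]
    by (simp add: power_mult_distrib)
  show "(LINT \<omega>|N. Y \<omega>) = 0"
    using int_eq[of "\<lambda>x. x"] integral_std_normal_distribution_moment_odd[of 1] by simp
  show "(LINT \<omega>|N. (Y \<omega>)\<^sup>2) = v"
    using int_eq[of "\<lambda>x. x\<^sup>2"] std_normal_distribution_even_moments(1)[of 1] v
    by (simp add: power_mult_distrib)
  show "gaussian_variable N Y"
  proof (cases "v = 0")
    case True
    have "AE x in distr std_normal_distribution borel (\<lambda>x. sqrt v * x). x = 0"
      by (subst AE_distr_iff) (simp_all add: True)
    then have "AE \<omega> in N. Y \<omega> = 0"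
      unfolding eq[symmetric] by (rule AE_distrD[OF Y])
    then show ?thesis
      using Y unfolding gaussian_variable_def by blast
  next
    case False
    have "distributed std_normal_distribution lborel (\<lambda>x. x) std_normal_density"
      by (simp add: distributed_def distr_id2)
    from std.normal_density_affine[OF this, of "sqrt v" 0]
    have "distributed std_normal_distribution lborel (\<lambda>x. sqrt v * x) (normal_density 0 (sqrt v))"
      using v False by simp
    then have "distributed N lborel Y (normal_density 0 (sqrt v))"
      using eq by (simp add: distributed_def cong: distr_cong)
    then show ?thesis
      using Y v False unfolding gaussian_variable_def
      by (intro conjI exI[of _ 0] disjI2 exI[of _ "sqrt v"]) auto
  qed
qed

text \<open>Scaling the coefficients by s turns the joint transform into the transform at frequency
  s of a single linear combination, whose variance is therefore the quadratic form of
  \<open>K\<close>.\<close>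

lemma gaussian_field_of_char:
  fixes X :: "'i \<Rightarrow> 'w \<Rightarrow> real"
  assumes "prob_space N" and psd: "psd_on S K"
    and X: "\<And>x. x \<in> S \<Longrightarrow> X x \<in> borel_measurable N"
    and char: "\<And>F c. finite F \<Longrightarrow> F \<subseteq> S \<Longrightarrow> (CLINT \<omega>|N. iexp (\<Sum>x\<in>F. c x * X x \<omega>))
      = of_real (exp (- (\<Sum>x\<in>F. \<Sum>y\<in>F. c x * c y * K x y) / 2))"
  shows "gaussian_field N S X"
    and "x \<in> S \<Longrightarrow> y \<in> S \<Longrightarrow> covariance N (X x) (X y) = K x y"
proof -
  have meas: "(\<lambda>\<omega>. \<Sum>x\<in>F. c x * X x \<omega>) \<in> borel_measurable N" if "F \<subseteq> S" for F c
    using that X by (intro borel_measurable_sum borel_measurable_times borel_measurable_const) auto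
  have lin: "(CLINT \<omega>|N. iexp (s * (\<Sum>x\<in>F. c x * X x \<omega>)))
      = of_real (exp (- (s\<^sup>2 * (\<Sum>x\<in>F. \<Sum>y\<in>F. c x * c y * K x y)) / 2))"
    if F: "finite F" "F \<subseteq> S" for F c s
  proof -
    have "(\<Sum>x\<in>F. (s * c x) * X x \<omega>) = s * (\<Sum>x\<in>F. c x * X x \<omega>)" for \<omega>
      by (simp add: sum_distrib_left mult_ac)
    moreover have "(\<Sum>x\<in>F. \<Sum>y\<in>F. (s * c x) * (s * c y) * K x y) = s\<^sup>2 * (\<Sum>x\<in>F. \<Sum>y\<in>F. c x * c y * K x y)"
      by (simp add: sum_distrib_left mult_ac power2_eq_square)
    ultimately show ?thesis
      using char[OF F, of "\<lambda>x. s * c x"] by (simp only:)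
  qed
  note gauss = gaussian_char_imp[OF \<open>prob_space N\<close> meas psd_on_nonneg[OF psd] lin]
  show "gaussian_field N S X"
    unfolding gaussian_field_def using \<open>prob_space N\<close> X gauss(1) by blast
  assume x: "x \<in> S" and y: "y \<in> S"
  have mean: "(LINT \<omega>|N. X z \<omega>) = 0" and sq_int: "integrable N (\<lambda>\<omega>. (X z \<omega>)\<^sup>2)"
    and sq: "(LINT \<omega>|N. (X z \<omega>)\<^sup>2) = K z z" if "z \<in> S" for z
    using gauss(2-4)[of "{z}" "\<lambda>_. 1"] that by simp_all
  \<comment> \<open>Polarization: the mixed moment comes from the second moments of the sum and of
    both terms. The diagonal is separate because the set {x, y} then collapses to one point and no
    longer represents the sum.\<close>
  show "covariance N (X x) (X y) = K x y"
  proof (cases "x = y")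
    case True
    then show ?thesis
      using x by (simp add: covariance_def mean sq flip: power2_eq_square)
  next
    case False
    have sum_int: "integrable N (\<lambda>\<omega>. (X x \<omega> + X y \<omega>)\<^sup>2)"
      and sum: "(LINT \<omega>|N. (X x \<omega> + X y \<omega>)\<^sup>2) = K x x + 2 * K x y + K y y"
      using gauss(3-4)[of "{x, y}" "\<lambda>_. 1"] x y False psd_on_sym[OF psd, of x y] by simp_all
    have "covariance N (X x) (X y) = (LINT \<omega>|N. ((X x \<omega> + X y \<omega>)\<^sup>2 - (X x \<omega>)\<^sup>2 - (X y \<omega>)\<^sup>2) / 2)"
      unfolding covariance_def using x y
      by (simp add: mean power2_eq_square algebra_simps)
    also have "\<dots> = K x y"
      using x y by (simp add: sum_int sq_int sum sq)
    finally show ?thesis .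
  qed
qed

text \<open>The transforms depend on the points only through the invariant \<open>K\<close>.
  Injectivity of \<open>A\<close>, from its determinant 1, lets a finite set and its coefficients be
  moved to the image without merging terms.\<close>

lemma stationary_of_char:
  fixes X :: "(real, 'n::finite option) vec \<Rightarrow> 'w \<Rightarrow> real"
  assumes "prob_space N"
    and X: "\<And>x. x \<in> hyperbolic_space \<Longrightarrow> X x \<in> borel_measurable N"
    and char: "\<And>F c. finite F \<Longrightarrow> F \<subseteq> hyperbolic_space \<Longrightarrow> (CLINT \<omega>|N. iexp (\<Sum>x\<in>F. c x * X x \<omega>))
      = of_real (exp (- (\<Sum>x\<in>F. \<Sum>y\<in>F. c x * c y * K x y) / 2))"
    and inv: "\<And>A x y. A \<in> SO_plus \<Longrightarrow> K (A *v x) (A *v y) = K x y"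
  shows "stationary N X"
  unfolding stationary_def
proof
  fix A :: "((real, 'n option) vec, 'n option) vec"
  assume A: "A \<in> SO_plus"
  then have inj: "inj ((*v) A)"
    by (intro inj_matrix_vector_mult) (simp add: SO_plus_def invertible_det_nz)
  show "field_law N hyperbolic_space (\<lambda>x. X (A *v x)) = field_law N hyperbolic_space X"
  proof (rule field_law_eqI)
    show "(\<lambda>\<omega>. X (A *v x) \<omega>) \<in> borel_measurable N" if "x \<in> hyperbolic_space" for x
      using X SO_plus_hyperbolic_space[OF A that] .
    fix J :: "(real, 'n option) vec set" and t :: "(real, 'n option) vec \<Rightarrow> real"
    assume J: "finite J" "J \<subseteq> hyperbolic_space"
    define u where "u y = t (inv ((*v) A) y)" for y
    have u: "u (A *v x) = t x" for x
      by (simp add: u_def inv_f_f[OF inj])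
    have inj_on: "inj_on ((*v) A) J"
      using inj by (rule inj_on_subset) simp
    have "(CLINT \<omega>|N. iexp (\<Sum>x\<in>J. t x * X (A *v x) \<omega>)) = (CLINT \<omega>|N. iexp (\<Sum>y\<in>(*v) A ` J. u y * X y \<omega>))"
      by (simp add: sum.reindex[OF inj_on] u o_def)
    also have "\<dots> = of_real (exp (- (\<Sum>x\<in>(*v) A ` J. \<Sum>y\<in>(*v) A ` J. u x * u y * K x y) / 2))"
      using J SO_plus_hyperbolic_space[OF A] by (intro char) auto
    also have "\<dots> = of_real (exp (- (\<Sum>x\<in>J. \<Sum>y\<in>J. t x * t y * K x y) / 2))"
      by (simp add: sum.reindex[OF inj_on] u o_def inv[OF A])
    finally show "(CLINT \<omega>|N. iexp (\<Sum>x\<in>J. t x * X (A *v x) \<omega>)) = (CLINT \<omega>|N. iexp (\<Sum>x\<in>J. t x * X x \<omega>))"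
      by (simp only: char[OF J])
  qed (use assms(1) X in auto)
qed

lemma psd_on_Phi:
  assumes "\<alpha> > 0"
  shows "psd_on hyperbolic_space (Phi \<alpha>)"
  unfolding psd_on_def
  by (auto intro: Phi_commute Phi_positive_type_real[OF assms])

theorem proposition4p1:
  fixes \<alpha> :: real
  assumes "CARD('n::finite) \<ge> 2" and "\<alpha> > 0"
  shows "positive_type (hyperbolic_space :: (real, 'n option) vec set)
           (\<lambda>x y. complex_of_real (Phi \<alpha> x y))
       \<and> uniform_limit_at_infinity
           (\<lambda>(x :: (real, 'n option) vec) y. hyp_dist x y powr \<alpha> * Phi \<alpha> x y) (\<alpha> * Gamma \<alpha>)
       \<and> (\<exists>(N :: ((real, 'n option) vec \<Rightarrow> real) measure) X.
            gaussian_field N (hyperbolic_space :: (real, 'n option) vec set) X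
          \<and> stationary N X
          \<and> (\<forall>x\<in>hyperbolic_space. \<forall>y\<in>hyperbolic_space. covariance N (X x) (X y) = Phi \<alpha> x y)
          \<and> uniform_power_decay \<alpha> (\<lambda>x y. covariance N (X x) (X y)))"
proof (intro conjI)
  show "positive_type (hyperbolic_space :: (real, 'n option) vec set) (\<lambda>x y. complex_of_real (Phi \<alpha> x y))"
    by (intro positive_type_of_real continuous_on_Phi Phi_positive_type_real assms Phi_commute)
  show lim: "uniform_limit_at_infinity
      (\<lambda>(x :: (real, 'n option) vec) y. hyp_dist x y powr \<alpha> * Phi \<alpha> x y) (\<alpha> * Gamma \<alpha>)"
    by (rule uniform_limit_Phi) fact
  let ?H = "hyperbolic_space :: (real, 'n option) vec set"
  let ?X = "\<lambda>(x :: (real, 'n option) vec) (\<omega> :: (real, 'n option) vec \<Rightarrow> real). \<omega> x"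
  have psd: "psd_on ?H (Phi \<alpha>)"
    by (rule psd_on_Phi) fact
  obtain N :: "((real, 'n option) vec \<Rightarrow> real) measure" where N: "prob_space N"
    and X: "\<And>x. x \<in> ?H \<Longrightarrow> ?X x \<in> borel_measurable N"
    and char: "\<And>F c. finite F \<Longrightarrow> F \<subseteq> ?H \<Longrightarrow> (CLINT \<omega>|N. iexp (\<Sum>x\<in>F. c x * ?X x \<omega>))
      = of_real (exp (- (\<Sum>x\<in>F. \<Sum>y\<in>F. c x * c y * Phi \<alpha> x y) / 2))"
    using gaussian_process_exists[OF psd] by blast
  have cov: "covariance N (?X x) (?X y) = Phi \<alpha> x y" if "x \<in> ?H" "y \<in> ?H" for x y
    by (rule gaussian_field_of_char(2)[OF N psd X char that])
  \<comment> \<open>Invariance of the kernel is immediate: \<open>Phi \<alpha>\<close> is built from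
    \<open>minkowski\<close>, which \<open>A\<close> preserves.\<close>
  have "stationary N ?X"
    by (rule stationary_of_char[OF N X char])
      (auto simp: SO_plus_def Phi_def Psi_def hyp_dist_def)
  moreover have "gaussian_field N ?H ?X"
    by (rule gaussian_field_of_char(1)[OF N psd X char])
  moreover have "uniform_power_decay \<alpha> (\<lambda>x y. covariance N (?X x) (?X y))"
    unfolding uniform_power_decay_def
  proof (intro exI conjI)
    show "\<alpha> * Gamma \<alpha> > 0"
      using \<open>\<alpha> > 0\<close> by (simp add: Gamma_real_pos)
    \<comment> \<open>The limit is tested only at points of the hyperboloid, where the covariance
      equals \<open>Phi \<alpha>\<close>.\<close>
    show "uniform_limit_at_infinity (\<lambda>x y. hyp_dist x y powr \<alpha> * covariance N (?X x) (?X y)) (\<alpha> * Gamma \<alpha>)"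
      using lim by (simp add: uniform_limit_at_infinity_def cov)
  qed
  ultimately show "\<exists>(N :: ((real, 'n option) vec \<Rightarrow> real) measure) X. gaussian_field N ?H X \<and> stationary N X
      \<and> (\<forall>x\<in>?H. \<forall>y\<in>?H. covariance N (X x) (X y) = Phi \<alpha> x y)
      \<and> uniform_power_decay \<alpha> (\<lambda>x y. covariance N (X x) (X y))"
    using cov by blast
qed

end
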